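(* Let $\Sigma$ be a simplicial complex on the finite vertex set $V$ with $n=\#V$. Let $\circ\in\{+,-,H\}$ and, for each $k$, let $\lambda_k^\circ=\max\sigma(\Delta_k^\circ)$ and $\mu_k^H=\min\sigma(\Delta_k^H)$. Then for every $1\le k\le\dim(\Sigma)$, \[(k+1-\alpha_k)\lambda_k^\circ+\alpha_k n\le (k+1)\lambda_{k-1}^\circ\] and \[(k+1-\beta_k)\mu_k^H+\beta_k n\ge (k+1)\mu_{k-1}^H .\]
   Context: A simplicial complex on a finite set $V$ is a family $\Sigma\subseteq\mathcal P(V)$ closed under taking subsets. $\Sigma_k$ is the set of $\sigma\in\Sigma$ with $\#\sigma=k+1$ (so $\Sigma_{-1}=\{\emptyset\}$ for nonempty $\Sigma$), and $\dim(\Sigma)=\max\{k\mid\Sigma_k\ne\emptyset\}$. Write $\tau\prec\sigma$ if $\tau\subseteq\sigma$ and $\#(\sigma\setminus\tau)=1$. $\mathcal K=\mathcal P(V)$ is the complete complex, $\mathcal K_k$ its simplices of cardinality $k+1$. $\ell^2(\Sigma_k)$ is the space of real (or complex) valued functions on $\Sigma_k$ with $\langle\phi,\psi\rangle=\sum_{\tau\in\Sigma_k}\phi(\tau)\overline{\psi(\tau)}$. Coboundary operators are linear maps $\delta_k:\ell^2(\Sigma_k)\to\ell^2(\Sigma_{k+1})$, $k\ge-1$, with $\delta_{k+1}\delta_k=0$ and $\delta_k1_\tau(\sigma)\in\{\pm1,0\}$, nonzero iff $\tau\prec\sigma$. They are chosen as follows: fix coboundary operators $\widehat\delta_k$ for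 $\mathcal K$ and put $\delta_k=\pi_{k+1}\widehat\delta_k\iota_k$, where $\iota_k:\ell^2(\Sigma_k)\to\ell^2(\mathcal K_k)$ is extension by zero and $\pi_k:\ell^2(\mathcal K_k)\to\ell^2(\Sigma_k)$ is restriction. (The usual oriented simplicial coboundary of the augmented cochain complex is an example; the spectra below do not depend on the choice.) Let $\partial_k=\delta_k^*$ be the adjoint and \[\Delta_k^+=\partial_k\delta_k,\qquad \Delta_k^-=\delta_{k-1}\partial_{k-1},\qquad \Delta_k^H=\Delta_k^++\Delta_k^-\qquad(k\ge0)\] acting on $\ell^2(\Sigma_k)$. $\sigma(A)$ denotes the spectrum of an operator $A$. Let $A_k=\{\sigma\in\mathcal K_{k+1}\setminus\Sigma_{k+1}\mid \text{there is }\tau\in\Sigma_k\text{ with }\tau\subseteq\sigma\}$ and \[\alpha_k=\min_{\sigma\in A_k}\#\{\tau\in\Sigma_k\mid\tau\subseteq\sigma\}-1,\qquad \beta_k=\max_{\sigma\in A_k}\#\{\tau\in\Sigma_k\mid\tau\subseteq\sigma\}-1,\] with $\alpha_k=\beta_k=0$ if $A_k=\emptyset$. *)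

theory Defs
  imports Complex_Main "Jordan_Normal_Form.Conjugate"
begin

definition simplicial_complex_on :: "'a set \<Rightarrow> 'a set set \<Rightarrow> bool" where
  "simplicial_complex_on V S \<longleftrightarrow> S \<subseteq> Pow V \<and> (\<forall>\<sigma>\<in>S. \<forall>\<tau>. \<tau> \<subseteq> \<sigma> \<longrightarrow> \<tau> \<in> S)"

text \<open>Dimensions are integers, since the empty simplex has dimension -1.\<close>

definition faces :: "'a set set \<Rightarrow> int \<Rightarrow> 'a set set" where
  "faces S k = {\<sigma>\<in>S. int (card \<sigma>) = k + 1}"

text \<open>The empty complex (without even the empty simplex) has dimension
  \<open>-\<infinity>\<close>; this is encoded by -2, which is below the dimension of every nonempty
  complex on a finite vertex set.\<close>

definition complex_dim :: "'a set set \<Rightarrow> int" where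
  "complex_dim S = (if S = {} then -2 else Max {k. faces S k \<noteq> {}})"

definition covered :: "'a set \<Rightarrow> 'a set \<Rightarrow> bool" (infix "\<prec>" 50) where
  "\<tau> \<prec> \<sigma> \<longleftrightarrow> \<tau> \<subseteq> \<sigma> \<and> card (\<sigma> - \<tau>) = 1"

text \<open>Scalar functions on a finite set \<open>X\<close> of simplices are represented by functions on
  all sets that vanish outside \<open>X\<close>.  Under this identification extension by zero from
  \<open>X\<close> to a larger set is the identity map, and restriction to \<open>X\<close> is cutting off
  outside \<open>X\<close>.  The scalars \<open>'f\<close> are meant to be \<open>real\<close> or \<open>complex\<close>.\<close>

definition ell2 :: "'a set set \<Rightarrow> ('a set \<Rightarrow> 'f::conjugatable_field) set" where
  "ell2 X = {\<phi>. \<forall>\<tau>. \<tau> \<notin> X \<longrightarrow> \<phi> \<tau> = 0}"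

definition restr :: "'a set set \<Rightarrow> ('a set \<Rightarrow> 'f::conjugatable_field) \<Rightarrow> 'a set \<Rightarrow> 'f" where
  "restr X \<phi> = (\<lambda>\<tau>. if \<tau> \<in> X then \<phi> \<tau> else 0)"

definition ell2_inner ::
    "'a set set \<Rightarrow> ('a set \<Rightarrow> 'f) \<Rightarrow> ('a set \<Rightarrow> 'f) \<Rightarrow> 'f::conjugatable_field" where
  "ell2_inner X \<phi> \<psi> = (\<Sum>\<tau>\<in>X. \<phi> \<tau> * conjugate (\<psi> \<tau>))"

type_synonym ('a, 'f) operator = "('a set \<Rightarrow> 'f) \<Rightarrow> 'a set \<Rightarrow> 'f"

definition linear_op ::
    "'a set set \<Rightarrow> 'a set set \<Rightarrow> ('a, 'f::conjugatable_field) operator \<Rightarrow> bool" where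
  "linear_op X Y F \<longleftrightarrow>
     (\<forall>\<phi>\<in>ell2 X. F \<phi> \<in> ell2 Y) \<and>
     (\<forall>\<phi>\<in>ell2 X. \<forall>\<psi>\<in>ell2 X. F (\<lambda>\<tau>. \<phi> \<tau> + \<psi> \<tau>) = (\<lambda>\<sigma>. F \<phi> \<sigma> + F \<psi> \<sigma>)) \<and>
     (\<forall>c. \<forall>\<phi>\<in>ell2 X. F (\<lambda>\<tau>. c * \<phi> \<tau>) = (\<lambda>\<sigma>. c * F \<phi> \<sigma>))"

definition adjoint_op ::
    "'a set set \<Rightarrow> 'a set set \<Rightarrow> ('a, 'f::conjugatable_field) operator \<Rightarrow> ('a, 'f) operator" where
  "adjoint_op X Y F \<psi> =
     (THE \<chi>. \<chi> \<in> ell2 X \<and> (\<forall>\<phi>\<in>ell2 X. ell2_inner Y (F \<phi>) \<psi> = ell2_inner X \<phi> \<chi>))"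

text \<open>The space \<open>ell2 X\<close> is finite-dimensional, so no boundedness of the inverse is required.\<close>

definition spectrum_op :: "'a set set \<Rightarrow> ('a, 'f::conjugatable_field) operator \<Rightarrow> 'f set" where
  "spectrum_op X A = {z. \<not> bij_betw (\<lambda>\<phi> \<tau>. A \<phi> \<tau> - z * \<phi> \<tau>) (ell2 X) (ell2 X)}"

definition indicator_fun :: "'a set \<Rightarrow> 'a set \<Rightarrow> 'f::conjugatable_field" where
  "indicator_fun \<tau> = (\<lambda>\<rho>. if \<rho> = \<tau> then 1 else 0)"

definition coboundary_ops ::
    "'a set set \<Rightarrow> (int \<Rightarrow> ('a, 'f::conjugatable_field) operator) \<Rightarrow> bool" where
  "coboundary_ops S d \<longleftrightarrow>
     (\<forall>k\<ge>-1. linear_op (faces S k) (faces S (k + 1)) (d k) \<and>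
        (\<forall>\<phi>\<in>ell2 (faces S k). d (k + 1) (d k \<phi>) = (\<lambda>_. 0)) \<and>
        (\<forall>\<tau>\<in>faces S k. \<forall>\<sigma>\<in>faces S (k + 1).
           d k (indicator_fun \<tau>) \<sigma> \<in> {1, -1, 0} \<and>
           (d k (indicator_fun \<tau>) \<sigma> \<noteq> 0 \<longleftrightarrow> \<tau> \<prec> \<sigma>)))"

text \<open>In the following, \<open>D\<close> is a system of coboundary operators on the complete complex.
  The extension by zero preceding \<open>D k\<close> is the identity in the chosen representation.\<close>

definition cobd ::
    "(int \<Rightarrow> ('a, 'f::conjugatable_field) operator) \<Rightarrow> 'a set set \<Rightarrow> int \<Rightarrow> ('a, 'f) operator" where
  "cobd D S k \<phi> = restr (faces S (k + 1)) (D k \<phi>)"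

definition bd ::
    "(int \<Rightarrow> ('a, 'f::conjugatable_field) operator) \<Rightarrow> 'a set set \<Rightarrow> int \<Rightarrow> ('a, 'f) operator" where
  "bd D S k = adjoint_op (faces S k) (faces S (k + 1)) (cobd D S k)"

datatype laplacian_kind = Up | Down | Hodge

definition laplacian_up ::
    "(int \<Rightarrow> ('a, 'f::conjugatable_field) operator) \<Rightarrow> 'a set set \<Rightarrow> int \<Rightarrow> ('a, 'f) operator" where
  "laplacian_up D S k \<phi> = bd D S k (cobd D S k \<phi>)"

definition laplacian_down ::
    "(int \<Rightarrow> ('a, 'f::conjugatable_field) operator) \<Rightarrow> 'a set set \<Rightarrow> int \<Rightarrow> ('a, 'f) operator" where
  "laplacian_down D S k \<phi> = cobd D S (k - 1) (bd D S (k - 1) \<phi>)"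

fun laplacian ::
    "(int \<Rightarrow> ('a, 'f::conjugatable_field) operator) \<Rightarrow> 'a set set \<Rightarrow> laplacian_kind \<Rightarrow> int
      \<Rightarrow> ('a, 'f) operator" where
  "laplacian D S Up k \<phi> = laplacian_up D S k \<phi>"
| "laplacian D S Down k \<phi> = laplacian_down D S k \<phi>"
| "laplacian D S Hodge k \<phi> = (\<lambda>\<tau>. laplacian_up D S k \<phi> \<tau> + laplacian_down D S k \<phi> \<tau>)"

definition laplacian_spectrum ::
    "(int \<Rightarrow> ('a, 'f::conjugatable_field) operator) \<Rightarrow> 'a set set \<Rightarrow> laplacian_kind \<Rightarrow> int
      \<Rightarrow> 'f set" where
  "laplacian_spectrum D S c k = spectrum_op (faces S k) (laplacian D S c k)"

definition missing :: "'a set \<Rightarrow> 'a set set \<Rightarrow> int \<Rightarrow> 'a set set" where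
  "missing V S k =
     {\<sigma> \<in> faces (Pow V) (k + 1) - faces S (k + 1). \<exists>\<tau>\<in>faces S k. \<tau> \<subseteq> \<sigma>}"

definition alpha :: "'a set \<Rightarrow> 'a set set \<Rightarrow> int \<Rightarrow> int" where
  "alpha V S k = (if missing V S k = {} then 0
     else (MIN \<sigma>\<in>missing V S k. int (card {\<tau>\<in>faces S k. \<tau> \<subseteq> \<sigma>})) - 1)"

definition beta :: "'a set \<Rightarrow> 'a set set \<Rightarrow> int \<Rightarrow> int" where
  "beta V S k = (if missing V S k = {} then 0
     else (MAX \<sigma>\<in>missing V S k. int (card {\<tau>\<in>faces S k. \<tau> \<subseteq> \<sigma>})) - 1)"

text \<open>The extremal eigenvalues as real numbers.  Over the complex numbers the spectrum is a
  set of complex numbers which, the Laplacians being self-adjoint, are all real; \<open>Re\<close>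
  only converts their type.\<close>

definition lambda_real ::
    "(int \<Rightarrow> ('a, real) operator) \<Rightarrow> 'a set set \<Rightarrow> laplacian_kind \<Rightarrow> int \<Rightarrow> real" where
  "lambda_real D S c k = Max (laplacian_spectrum D S c k)"

definition mu_real ::
    "(int \<Rightarrow> ('a, real) operator) \<Rightarrow> 'a set set \<Rightarrow> laplacian_kind \<Rightarrow> int \<Rightarrow> real" where
  "mu_real D S c k = Min (laplacian_spectrum D S c k)"

definition lambda_complex ::
    "(int \<Rightarrow> ('a, complex) operator) \<Rightarrow> 'a set set \<Rightarrow> laplacian_kind \<Rightarrow> int \<Rightarrow> real" where
  "lambda_complex D S c k = Max (Re ` laplacian_spectrum D S c k)"

definition mu_complex ::
    "(int \<Rightarrow> ('a, complex) operator) \<Rightarrow> 'a set set \<Rightarrow> laplacian_kind \<Rightarrow> int \<Rightarrow> real" where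
  "mu_complex D S c k = Min (Re ` laplacian_spectrum D S c k)"

end

(*
  For a vertex v let i_v be the contraction (i_v phi)(tau) = +-phi(insert v tau), with the sign
  taken from the coboundary of the full simplex.  On the full simplex the vanishing of the squared
  coboundary amounts to i_v d + d i_v = id, and the adjoint of d is the sum of the i_v; hence
  |d phi|^2 + |d* phi|^2 = n |phi|^2.  Summing the quadratic forms of the (k-1)-Laplacians of S
  over the i_v phi gives, for phi supported on the k-faces,
    sum_v |d_S i_v phi|^2 = n |phi|^2 + sum_sigma (m(sigma) - 2) |(d phi)(sigma)|^2,
    sum_v |d* i_v phi|^2 = k |d* phi|^2,    sum_v |i_v phi|^2 = (k+1) |phi|^2,
  where m(sigma) counts the facets of sigma in S: it is k+2 on faces of S and lies between alpha+1
  and beta+1 on the other sigma where d phi can be nonzero.  For the Hodge Laplacian one inserts an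
  extremal eigenfunction phi.  For the upper Laplacian d* phi = 0 unless the top eigenvalue is 0;
  in that case phi = d_S psi with psi a top eigenfunction one dimension lower, together with
  |d_S psi|^2 <= lambda (|psi|^2 - |d* psi|^2 / n), gives a quadratic inequality for lambda.  For
  the lower Laplacian the identity is applied one dimension lower to d* phi.

  Complex scalars reduce to real ones by taking real and imaginary parts of eigenfunctions.
*)

theory Submission
  imports Defs "Jordan_Normal_Form.Spectral_Radius"
begin

section \<open>Eigenvalues of operators on finitely supported functions\<close>

text \<open>In the Hodge case the coefficients balance: bounding m(\<sigma>) - 2 from below by
  \<alpha> - 1 on the non-faces leaves k + 1 - \<alpha> in front of |d_S phi|^2 and 1 - \<alpha> in
  front of |d* phi|^2, and the lower form adds k to the latter, so only the eigenvalue remains. Each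
  half of the Laplacian alone loses this balance. If the top upper eigenvalue is 0, the claim is
  \<alpha> n \<le> (k+1) \<lambda>, with \<lambda> one dimension lower. A plain Rayleigh bound with
  phi = d_S psi gives only \<alpha> n \<le> (k+\<alpha>) \<lambda>; the gain |d* psi|^2 / n closes
  the gap. For the lower Laplacian, inserting its eigenfunction directly compares k times the
  eigenvalue in dimension k with k + 1 times the one below, without any \<alpha>. Passing to d* phi
  brings d_S back, but then \<alpha>, which is defined by missing (k+1)-simplices, has to bound
  facet counts of k-simplices. Of the spectra only two facts enter: an extremal eigenvalue has an
  eigenfunction, and it bounds all Rayleigh quotients.\<close>

lemma ell2_I: "(\<And>\<tau>. \<tau> \<notin> X \<Longrightarrow> \<phi> \<tau> = 0) \<Longrightarrow> \<phi> \<in> ell2 X"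
  by (simp add: ell2_def)

lemma ell2_D: "\<phi> \<in> ell2 X \<Longrightarrow> \<tau> \<notin> X \<Longrightarrow> \<phi> \<tau> = 0"
  by (simp add: ell2_def)

lemma indicator_in_ell2: "\<tau> \<in> X \<Longrightarrow> indicator_fun \<tau> \<in> ell2 X"
  by (auto simp: ell2_def indicator_fun_def)

lemma restr_in_ell2: "restr X \<phi> \<in> ell2 X"
  by (simp add: ell2_def restr_def)

lemma restr_id: "\<phi> \<in> ell2 X \<Longrightarrow> restr X \<phi> = \<phi>"
  by (auto simp: ell2_def restr_def)

lemma linear_op_closed: "linear_op X Y F \<Longrightarrow> \<phi> \<in> ell2 X \<Longrightarrow> F \<phi> \<in> ell2 Y"
  by (simp add: linear_op_def)

lemma linear_op_add:
  "linear_op X Y F \<Longrightarrow> \<phi> \<in> ell2 X \<Longrightarrow> \<psi> \<in> ell2 X \<Longrightarrow>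
    F (\<lambda>\<tau>. \<phi> \<tau> + \<psi> \<tau>) = (\<lambda>\<sigma>. F \<phi> \<sigma> + F \<psi> \<sigma>)"
  by (simp add: linear_op_def)

lemma linear_op_scale:
  "linear_op X Y F \<Longrightarrow> \<phi> \<in> ell2 X \<Longrightarrow> F (\<lambda>\<tau>. c * \<phi> \<tau>) = (\<lambda>\<sigma>. c * F \<phi> \<sigma>)"
  by (simp add: linear_op_def)

lemma linear_op_zero:
  assumes "linear_op X Y F"
  shows "F (\<lambda>_. 0) = (\<lambda>_. 0)"
  using linear_op_scale[OF assms, of "\<lambda>_. 0" 0] by (simp add: ell2_def)

lemma linear_op_diff:
  assumes F: "linear_op X Y F" and "\<phi> \<in> ell2 X" "\<psi> \<in> ell2 X"
  shows "F (\<lambda>\<tau>. \<phi> \<tau> - \<psi> \<tau>) = (\<lambda>\<sigma>. F \<phi> \<sigma> - F \<psi> \<sigma>)"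
proof -
  have "(\<lambda>\<tau>. -1 * \<psi> \<tau>) \<in> ell2 X" using assms(3) by (simp add: ell2_def)
  from linear_op_add[OF F assms(2) this] linear_op_scale[OF F assms(3), where c = "-1"]
  show ?thesis by simp
qed

lemma linear_op_expand:
  assumes "finite X" and F: "linear_op X Y F" and \<phi>: "\<phi> \<in> ell2 X"
  shows "F \<phi> \<sigma> = (\<Sum>\<tau>\<in>X. \<phi> \<tau> * F (indicator_fun \<tau>) \<sigma>)"
proof -
  have "F (restr Z \<phi>) \<sigma> = (\<Sum>\<tau>\<in>Z. \<phi> \<tau> * F (indicator_fun \<tau>) \<sigma>)" if "finite Z" "Z \<subseteq> X" for Z
    using that
  proof (induction Z rule: finite_induct)
    case empty
    then show ?case using linear_op_zero[OF F] by (simp add: restr_def)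
  next
    case (insert t Z)
    have 1: "restr (insert t Z) \<phi> = (\<lambda>\<tau>. restr Z \<phi> \<tau> + \<phi> t * indicator_fun t \<tau>)"
      using insert.hyps by (auto simp: restr_def indicator_fun_def)
    have 2: "restr Z \<phi> \<in> ell2 X"
      using insert.prems by (auto simp: restr_def ell2_def)
    have 3: "indicator_fun t \<in> ell2 X"
      using insert.prems by (simp add: indicator_in_ell2)
    then have 4: "(\<lambda>\<tau>. \<phi> t * indicator_fun t \<tau>) \<in> ell2 X" by (auto simp: ell2_def)
    show ?case
      using insert linear_op_add[OF F 2 4] linear_op_scale[OF F 3, of "\<phi> t"]
      by (simp add: 1 algebra_simps)
  qed
  from this[OF assms(1)] show ?thesis by (simp add: restr_id[OF \<phi>])
qed

text \<open>An enumeration of \<open>X\<close> makes \<open>cv\<close> and \<open>fv\<close>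
  mutually inverse coordinate maps. The dictionary serves to import two facts about matrices:
  finiteness of the spectrum and invertibility for nonzero determinant.\<close>

lemma linear_op_matrix:
  fixes F :: "('a, 'f::conjugatable_field) operator"
  assumes fin: "finite X" and F: "linear_op X X F"
  obtains n and M :: "'f mat" and cv :: "('a set \<Rightarrow> 'f) \<Rightarrow> 'f vec" and fv :: "'f vec \<Rightarrow> 'a set \<Rightarrow> 'f"
  where "M \<in> carrier_mat n n"
    and "\<And>\<phi>. cv \<phi> \<in> carrier_vec n"
    and "\<And>\<phi>. \<phi> \<in> ell2 X \<Longrightarrow> M *\<^sub>v cv \<phi> = cv (F \<phi>)"
    and "\<And>\<phi>. \<phi> \<in> ell2 X \<Longrightarrow> fv (cv \<phi>) = \<phi>"
    and "\<And>v. fv v \<in> ell2 X"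
    and "\<And>v. v \<in> carrier_vec n \<Longrightarrow> cv (fv v) = v"
    and "\<And>c \<phi>. cv (\<lambda>\<tau>. c * \<phi> \<tau>) = c \<cdot>\<^sub>v cv \<phi>"
    and "cv (\<lambda>_. 0) = 0\<^sub>v n"
proof -
  define n where "n = card X"
  obtain h where h: "bij_betw h {0..<n} X"
    using ex_bij_betw_nat_finite[OF fin] unfolding n_def by blast
  define M where "M = mat n n (\<lambda>(i, j). F (indicator_fun (h j)) (h i))"
  define cv where "cv \<phi> = vec n (\<lambda>i. \<phi> (h i))" for \<phi> :: "'a set \<Rightarrow> 'f"
  define fv where "fv v = (\<lambda>\<tau>. if \<tau> \<in> X then v $ inv_into {0..<n} h \<tau> else 0)" for v :: "'f vec"
  have hX: "h i \<in> X" if "i < n" for i using bij_betwE[OF h] that by auto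
  show ?thesis
  proof
    show "M \<in> carrier_mat n n" by (simp add: M_def)
    show "cv \<phi> \<in> carrier_vec n" for \<phi> by (simp add: cv_def)
    show "fv v \<in> ell2 X" for v by (simp add: fv_def ell2_def)
    show "cv (\<lambda>\<tau>. c * \<phi> \<tau>) = c \<cdot>\<^sub>v cv \<phi>" for c \<phi> by (auto simp: cv_def)
    show "cv (\<lambda>_. 0) = 0\<^sub>v n" by (auto simp: cv_def)
    show "M *\<^sub>v cv \<phi> = cv (F \<phi>)" if \<phi>: "\<phi> \<in> ell2 X" for \<phi>
    proof (rule eq_vecI)
      fix i assume "i < dim_vec (cv (F \<phi>))"
      then have i: "i < n" by (simp add: cv_def)
      then have "(M *\<^sub>v cv \<phi>) $ i = (\<Sum>j\<in>{0..<n}. F (indicator_fun (h j)) (h i) * \<phi> (h j))"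
        by (simp add: M_def cv_def scalar_prod_def)
      also have "\<dots> = (\<Sum>\<tau>\<in>X. F (indicator_fun \<tau>) (h i) * \<phi> \<tau>)"
        by (rule sum.reindex_bij_betw[OF h])
      also have "\<dots> = F \<phi> (h i)"
        by (simp add: linear_op_expand[OF fin F \<phi>] mult.commute)
      finally show "(M *\<^sub>v cv \<phi>) $ i = cv (F \<phi>) $ i" using i by (simp add: cv_def)
    qed (simp add: M_def cv_def)
    show "fv (cv \<phi>) = \<phi>" if "\<phi> \<in> ell2 X" for \<phi>
    proof
      fix \<tau>
      show "fv (cv \<phi>) \<tau> = \<phi> \<tau>"
      proof (cases "\<tau> \<in> X")
        case True
        then have "\<tau> \<in> h ` {0..<n}" using bij_betw_imp_surj_on[OF h] by simp
        then have "inv_into {0..<n} h \<tau> \<in> {0..<n}" "h (inv_into {0..<n} h \<tau>) = \<tau>"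
          by (rule inv_into_into, rule f_inv_into_f)
        then show ?thesis using True by (simp add: fv_def cv_def)
      next
        case False
        then show ?thesis using that by (simp add: fv_def ell2_def)
      qed
    qed
    show "cv (fv v) = v" if "v \<in> carrier_vec n" for v
      using that hX inv_into_f_f[OF bij_betw_imp_inj_on[OF h]]
      by (intro eq_vecI) (auto simp: fv_def cv_def)
  qed
qed

definition eigenfunction ::
    "'a set set \<Rightarrow> ('a, 'f::conjugatable_field) operator \<Rightarrow> 'f \<Rightarrow> ('a set \<Rightarrow> 'f) \<Rightarrow> bool" where
  "eigenfunction X F z \<phi> \<longleftrightarrow> \<phi> \<in> ell2 X \<and> \<phi> \<noteq> (\<lambda>_. 0) \<and> F \<phi> = (\<lambda>\<tau>. z * \<phi> \<tau>)"

text \<open>Gives \<open>Max\<close> and \<open>Min\<close> of a spectrum their meaning, since both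
  are specified by their order properties only on finite sets.\<close>

lemma finite_eigenvalues:
  fixes F :: "('a, 'f::conjugatable_field) operator"
  assumes "finite X" and "linear_op X X F"
  shows "finite {z. \<exists>\<phi>. eigenfunction X F z \<phi>}"
proof -
  obtain M :: "'f mat" and n cv fv where m: "M \<in> carrier_mat n n"
    "\<And>\<phi>. cv \<phi> \<in> carrier_vec n"
    "\<And>\<phi>. \<phi> \<in> ell2 X \<Longrightarrow> M *\<^sub>v cv \<phi> = cv (F \<phi>)"
    "\<And>\<phi>. \<phi> \<in> ell2 X \<Longrightarrow> fv (cv \<phi>) = \<phi>"
    "\<And>v. fv v \<in> ell2 X"
    "\<And>v. v \<in> carrier_vec n \<Longrightarrow> cv (fv v) = v"
    "\<And>c \<phi>. cv (\<lambda>\<tau>. c * \<phi> \<tau>) = c \<cdot>\<^sub>v cv \<phi>"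
    "cv (\<lambda>_. 0) = 0\<^sub>v n"
    by (rule linear_op_matrix[OF assms]) (rule that)
  have "z \<in> spectrum M" if e: "eigenfunction X F z \<phi>" for z \<phi>
  proof -
    have "cv \<phi> \<noteq> 0\<^sub>v n"
    proof
      assume "cv \<phi> = 0\<^sub>v n"
      then have "cv \<phi> = cv (\<lambda>_. 0)" using m(8) by simp
      then have "\<phi> = (\<lambda>_. 0)"
        using m(4)[of \<phi>] m(4)[of "\<lambda>_. 0"] e by (simp add: eigenfunction_def ell2_def)
      with e show False by (simp add: eigenfunction_def)
    qed
    then have "eigenvector M (cv \<phi>) z"
      using m(1,2,3,7) e carrier_matD(1)[OF m(1)] by (simp add: eigenfunction_def eigenvector_def)
    then show ?thesis by (auto simp: spectrum_def eigenvalue_def)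
  qed
  then have "{z. \<exists>\<phi>. eigenfunction X F z \<phi>} \<subseteq> spectrum M" by blast
  then show ?thesis using card_finite_spectrum(1)[OF m(1)] finite_subset by blast
qed

text \<open>Finite dimension enters here: a zero determinant would produce a kernel vector, and a
  nonzero one gives a right inverse matrix, hence surjectivity.\<close>

lemma linear_op_trivial_kernel_bij:
  fixes F :: "('a, 'f::conjugatable_field) operator"
  assumes fin: "finite X" and F: "linear_op X X F"
    and ker: "\<And>\<phi>. \<phi> \<in> ell2 X \<Longrightarrow> F \<phi> = (\<lambda>_. 0) \<Longrightarrow> \<phi> = (\<lambda>_. 0)"
  shows "bij_betw F (ell2 X) (ell2 X)"
proof -
  have inj: "inj_on F (ell2 X)"
  proof (rule inj_onI)
    fix \<phi> \<psi> assume *: "\<phi> \<in> ell2 X" "\<psi> \<in> ell2 X" "F \<phi> = F \<psi>"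
    have "F (\<lambda>\<tau>. \<phi> \<tau> - \<psi> \<tau>) = (\<lambda>_. 0)"
      unfolding linear_op_diff[OF F *(1,2)] *(3) by simp
    moreover have "(\<lambda>\<tau>. \<phi> \<tau> - \<psi> \<tau>) \<in> ell2 X" using *(1,2) by (simp add: ell2_def)
    ultimately have "(\<lambda>\<tau>. \<phi> \<tau> - \<psi> \<tau>) = (\<lambda>_. 0)" using ker by blast
    then show "\<phi> = \<psi>" by (auto simp: fun_eq_iff)
  qed
  obtain M :: "'f mat" and n cv fv where m: "M \<in> carrier_mat n n"
    "\<And>\<phi>. cv \<phi> \<in> carrier_vec n"
    "\<And>\<phi>. \<phi> \<in> ell2 X \<Longrightarrow> M *\<^sub>v cv \<phi> = cv (F \<phi>)"
    "\<And>\<phi>. \<phi> \<in> ell2 X \<Longrightarrow> fv (cv \<phi>) = \<phi>"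
    "\<And>v. fv v \<in> ell2 X"
    "\<And>v. v \<in> carrier_vec n \<Longrightarrow> cv (fv v) = v"
    "\<And>c \<phi>. cv (\<lambda>\<tau>. c * \<phi> \<tau>) = c \<cdot>\<^sub>v cv \<phi>"
    "cv (\<lambda>_. 0) = 0\<^sub>v n"
    by (rule linear_op_matrix[OF fin F]) (rule that)
  have "det M \<noteq> 0"
  proof
    assume "det M = 0"
    then obtain v where v: "v \<in> carrier_vec n" "v \<noteq> 0\<^sub>v n" "M *\<^sub>v v = 0\<^sub>v n"
      using det_0_iff_vec_prod_zero_field[OF m(1)] by blast
    have "cv (F (fv v)) = cv (\<lambda>_. 0)" unfolding m(3)[OF m(5), symmetric] m(6)[OF v(1)] m(8) by (rule v(3))
    then have "fv (cv (F (fv v))) = fv (cv (\<lambda>_. 0))" by (rule arg_cong)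
    moreover have "fv (cv (\<lambda>_. 0)) = (\<lambda>_. 0)" by (rule m(4)) (simp add: ell2_def)
    ultimately have "F (fv v) = (\<lambda>_. 0)"
      unfolding m(4)[OF linear_op_closed[OF F m(5)]] by (rule trans)
    then have "fv v = (\<lambda>_. 0)" by (rule ker[OF m(5)])
    then have "v = cv (\<lambda>_. 0)" using m(6)[OF v(1)] by (simp only:)
    then show False using v(2) by (simp only: m(8))
  qed
  \<comment> \<open>The unit element \<open>()\<close> only fills the extension parameter of the
    matrix ring record.\<close>
  from det_non_zero_imp_unit[OF m(1) this, of "()"] obtain B where
    B: "B \<in> carrier_mat n n" "M * B = 1\<^sub>m n"
    unfolding Units_def ring_mat_def by auto
  have "\<psi> \<in> F ` ell2 X" if \<psi>: "\<psi> \<in> ell2 X" for \<psi>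
  proof -
    define v where "v = B *\<^sub>v cv \<psi>"
    have v: "v \<in> carrier_vec n" using B m(2) by (simp add: v_def)
    have "cv (F (fv v)) = M *\<^sub>v v" unfolding m(3)[OF m(5), symmetric] m(6)[OF v] ..
    also have "\<dots> = cv \<psi>"
      unfolding v_def using assoc_mult_mat_vec[OF m(1) B(1) m(2), symmetric] B(2) m(2) by simp
    finally have "F (fv v) = \<psi>"
      using arg_cong[of _ _ fv] m(4)[OF \<psi>] m(4)[OF linear_op_closed[OF F m(5)], of v] by metis
    then show ?thesis using m(5) by blast
  qed
  then show ?thesis
    using inj linear_op_closed[OF F] unfolding bij_betw_def by blast
qed

lemma linear_op_shift:
  assumes "linear_op X X F"
  shows "linear_op X X (\<lambda>\<phi> \<tau>. F \<phi> \<tau> - z * \<phi> \<tau>)"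
  using assms unfolding linear_op_def by (auto simp: ell2_def algebra_simps fun_eq_iff)

text \<open>In finite dimension the shifted operator is bijective exactly when its kernel is
  trivial, so spectral values and eigenvalues coincide.\<close>

lemma spectrum_op_eigenfunction:
  fixes F :: "('a, 'f::conjugatable_field) operator"
  assumes fin: "finite X" and F: "linear_op X X F"
  shows "spectrum_op X F = {z. \<exists>\<phi>. eigenfunction X F z \<phi>}"
proof (intro Collect_cong[of "\<lambda>z. \<not> bij_betw (\<lambda>\<phi> \<tau>. F \<phi> \<tau> - z * \<phi> \<tau>) (ell2 X) (ell2 X)",
      folded spectrum_op_def] iffI)
  fix z
  let ?G = "\<lambda>\<phi> \<tau>. F \<phi> \<tau> - z * \<phi> \<tau>"
  note G = linear_op_shift[OF F, of z]
  show "\<exists>\<phi>. eigenfunction X F z \<phi>" if "\<not> bij_betw ?G (ell2 X) (ell2 X)"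
  proof (rule ccontr)
    assume no: "\<not> (\<exists>\<phi>. eigenfunction X F z \<phi>)"
    have "bij_betw ?G (ell2 X) (ell2 X)"
    proof (rule linear_op_trivial_kernel_bij[OF fin G])
      fix \<phi> :: "'a set \<Rightarrow> 'f"
      assume \<phi>: "\<phi> \<in> ell2 X" and "?G \<phi> = (\<lambda>_. 0)"
      then have "F \<phi> = (\<lambda>\<tau>. z * \<phi> \<tau>)" by (simp add: fun_eq_iff)
      with no \<phi> show "\<phi> = (\<lambda>_. 0)" unfolding eigenfunction_def by blast
    qed
    with that show False ..
  qed
  show "\<not> bij_betw ?G (ell2 X) (ell2 X)" if "\<exists>\<phi>. eigenfunction X F z \<phi>"
  proof
    assume b: "bij_betw ?G (ell2 X) (ell2 X)"
    from that obtain \<phi> where \<phi>: "\<phi> \<in> ell2 X" "\<phi> \<noteq> (\<lambda>_. 0)" "F \<phi> = (\<lambda>\<tau>. z * \<phi> \<tau>)"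
      unfolding eigenfunction_def by blast
    have "?G \<phi> = ?G (\<lambda>_. 0)" using \<phi>(3) linear_op_zero[OF G] by (simp add: fun_eq_iff)
    then have "\<phi> = (\<lambda>_. 0)"
      by (rule inj_onD[OF bij_betw_imp_inj_on[OF b]]) (use \<phi>(1) in \<open>auto simp: ell2_def\<close>)
    with \<phi>(2) show False ..
  qed
qed

section \<open>Symmetric operators\<close>

lemma ell2_inner_real: "ell2_inner X \<phi> \<psi> = (\<Sum>\<tau>\<in>X. \<phi> \<tau> * \<psi> \<tau>)" for \<phi> :: "'a set \<Rightarrow> real"
  by (simp add: ell2_inner_def)

lemma ell2_inner_self_nonneg: "0 \<le> ell2_inner X \<phi> \<phi>" for \<phi> :: "'a set \<Rightarrow> real"
  by (simp add: ell2_inner_real sum_nonneg)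

lemma ell2_inner_self_pos:
  fixes \<phi> :: "'a set \<Rightarrow> real"
  assumes "finite X" "\<phi> \<in> ell2 X" "\<phi> \<noteq> (\<lambda>_. 0)"
  shows "0 < ell2_inner X \<phi> \<phi>"
proof -
  obtain \<tau> where "\<phi> \<tau> \<noteq> 0" "\<tau> \<in> X" using assms(2,3) by (auto simp: ell2_def fun_eq_iff)
  with assms(1) show ?thesis
    unfolding ell2_inner_real by (intro sum_pos2[of X \<tau>]) (auto simp: zero_less_mult_iff)
qed

lemma ell2_inner_commute: "ell2_inner X \<phi> \<psi> = ell2_inner X \<psi> \<phi>" for \<phi> :: "'a set \<Rightarrow> real"
  by (simp add: ell2_inner_real mult.commute)

lemma ell2_inner_add_left:
  "ell2_inner X (\<lambda>\<tau>. \<phi> \<tau> + \<psi> \<tau>) \<chi> = ell2_inner X \<phi> \<chi> + ell2_inner X \<psi> \<chi>"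
  for \<phi> :: "'a set \<Rightarrow> real"
  by (simp add: ell2_inner_real algebra_simps sum.distrib)

lemma ell2_inner_diff_left:
  "ell2_inner X (\<lambda>\<tau>. \<phi> \<tau> - \<psi> \<tau>) \<chi> = ell2_inner X \<phi> \<chi> - ell2_inner X \<psi> \<chi>"
  for \<phi> :: "'a set \<Rightarrow> real"
  by (simp add: ell2_inner_real algebra_simps sum_subtractf)

lemma ell2_inner_scale_left:
  "ell2_inner X (\<lambda>\<tau>. c * \<phi> \<tau>) \<chi> = c * ell2_inner X \<phi> \<chi>" for \<phi> :: "'a set \<Rightarrow> real"
  by (simp add: ell2_inner_real algebra_simps sum_distrib_left)

lemma ell2_inner_diff_right:
  "ell2_inner X \<chi> (\<lambda>\<tau>. \<phi> \<tau> - \<psi> \<tau>) = ell2_inner X \<chi> \<phi> - ell2_inner X \<chi> \<psi>"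
  for \<phi> :: "'a set \<Rightarrow> real"
  by (simp add: ell2_inner_real algebra_simps sum_subtractf)

lemma ell2_inner_scale_right:
  "ell2_inner X \<chi> (\<lambda>\<tau>. c * \<phi> \<tau>) = c * ell2_inner X \<chi> \<phi>" for \<phi> :: "'a set \<Rightarrow> real"
  by (simp add: ell2_inner_real algebra_simps sum_distrib_left)

lemmas ell2_inner_linear =
  ell2_inner_diff_left ell2_inner_scale_left ell2_inner_diff_right ell2_inner_scale_right

text \<open>Any crude constant suffices; here it is the sum of the absolute values of all matrix
  entries, as each product of two values of \<phi> is at most the squared norm. It bounds the
  Rayleigh quotients, and below also the quadratic form of an inverse operator.\<close>

lemma linear_op_quadratic_bound:
  fixes F :: "('a, real) operator"
  assumes fin: "finite X" and F: "linear_op X X F"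
  obtains C where "\<And>\<phi>. \<phi> \<in> ell2 X \<Longrightarrow> ell2_inner X (F \<phi>) \<phi> \<le> C * ell2_inner X \<phi> \<phi>"
proof
  define C where "C = (\<Sum>\<sigma>\<in>X. \<Sum>\<tau>\<in>X. \<bar>F (indicator_fun \<tau>) \<sigma>\<bar>)"
  fix \<phi> :: "'a set \<Rightarrow> real" assume \<phi>: "\<phi> \<in> ell2 X"
  let ?N = "ell2_inner X \<phi> \<phi>"
  have sq: "\<phi> \<tau> * \<phi> \<tau> \<le> ?N" if "\<tau> \<in> X" for \<tau>
    unfolding ell2_inner_real using fin that by (intro member_le_sum) auto
  have prod: "\<bar>\<phi> \<tau> * \<phi> \<sigma>\<bar> \<le> ?N" if "\<tau> \<in> X" "\<sigma> \<in> X" for \<tau> \<sigma>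
  proof -
    have "0 \<le> (\<bar>\<phi> \<tau>\<bar> - \<bar>\<phi> \<sigma>\<bar>) * (\<bar>\<phi> \<tau>\<bar> - \<bar>\<phi> \<sigma>\<bar>)" by simp
    then have "2 * (\<bar>\<phi> \<tau>\<bar> * \<bar>\<phi> \<sigma>\<bar>) \<le> \<bar>\<phi> \<tau>\<bar> * \<bar>\<phi> \<tau>\<bar> + \<bar>\<phi> \<sigma>\<bar> * \<bar>\<phi> \<sigma>\<bar>"
      by (simp only: algebra_simps)
    then show ?thesis
      using sq[OF that(1)] sq[OF that(2)] by (simp add: abs_mult)
  qed
  have "ell2_inner X (F \<phi>) \<phi> = (\<Sum>\<sigma>\<in>X. \<Sum>\<tau>\<in>X. F (indicator_fun \<tau>) \<sigma> * (\<phi> \<tau> * \<phi> \<sigma>))"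
    unfolding ell2_inner_real
    by (simp add: linear_op_expand[OF fin F \<phi>] sum_distrib_left sum_distrib_right mult_ac)
  also have "\<dots> \<le> (\<Sum>\<sigma>\<in>X. \<Sum>\<tau>\<in>X. \<bar>F (indicator_fun \<tau>) \<sigma>\<bar> * ?N)"
  proof (intro sum_mono)
    fix \<sigma> \<tau> assume "\<sigma> \<in> X" "\<tau> \<in> X"
    have "F (indicator_fun \<tau>) \<sigma> * (\<phi> \<tau> * \<phi> \<sigma>) \<le> \<bar>F (indicator_fun \<tau>) \<sigma>\<bar> * \<bar>\<phi> \<tau> * \<phi> \<sigma>\<bar>"
      by (metis abs_ge_self abs_mult)
    also have "\<dots> \<le> \<bar>F (indicator_fun \<tau>) \<sigma>\<bar> * ?N"
      by (intro mult_left_mono prod \<open>\<sigma> \<in> X\<close> \<open>\<tau> \<in> X\<close>) simp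
    finally show "F (indicator_fun \<tau>) \<sigma> * (\<phi> \<tau> * \<phi> \<sigma>) \<le> \<bar>F (indicator_fun \<tau>) \<sigma>\<bar> * ?N" .
  qed
  also have "\<dots> = C * ?N" by (simp add: C_def sum_distrib_right)
  finally show "ell2_inner X (F \<phi>) \<phi> \<le> C * ?N" .
qed

lemma linear_op_inverse:
  assumes F: "linear_op X X F" and bij: "bij_betw F (ell2 X) (ell2 X)"
  shows "linear_op X X (inv_into (ell2 X) F)"
proof -
  let ?G = "inv_into (ell2 X) F"
  have G: "?G \<psi> \<in> ell2 X" "F (?G \<psi>) = \<psi>" if "\<psi> \<in> ell2 X" for \<psi>
    using that bij_betw_imp_surj_on[OF bij] inv_into_into[of \<psi> F "ell2 X"]
      f_inv_into_f[of \<psi> F "ell2 X"] by auto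
  have eq: "?G \<psi> = \<phi>" if "\<phi> \<in> ell2 X" "F \<phi> = \<psi>" for \<phi> \<psi>
    using that inv_into_f_f[OF bij_betw_imp_inj_on[OF bij]] by blast
  show ?thesis
    unfolding linear_op_def
  proof (intro conjI ballI allI)
    show "?G \<phi> \<in> ell2 X" if "\<phi> \<in> ell2 X" for \<phi> using G that by blast
    show "?G (\<lambda>\<tau>. \<phi> \<tau> + \<psi> \<tau>) = (\<lambda>\<sigma>. ?G \<phi> \<sigma> + ?G \<psi> \<sigma>)"
      if "\<phi> \<in> ell2 X" "\<psi> \<in> ell2 X" for \<phi> \<psi>
    proof (rule eq)
      show "(\<lambda>\<sigma>. ?G \<phi> \<sigma> + ?G \<psi> \<sigma>) \<in> ell2 X"
        using G(1) that by (simp add: ell2_def)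
      show "F (\<lambda>\<sigma>. ?G \<phi> \<sigma> + ?G \<psi> \<sigma>) = (\<lambda>\<tau>. \<phi> \<tau> + \<psi> \<tau>)"
        unfolding linear_op_add[OF F G(1)[OF that(1)] G(1)[OF that(2)]] G(2)[OF that(1)] G(2)[OF that(2)] ..
    qed
    show "?G (\<lambda>\<tau>. c * \<phi> \<tau>) = (\<lambda>\<sigma>. c * ?G \<phi> \<sigma>)" if "\<phi> \<in> ell2 X" for c \<phi>
    proof (rule eq)
      show "(\<lambda>\<sigma>. c * ?G \<phi> \<sigma>) \<in> ell2 X"
        using G(1)[OF that] by (simp add: ell2_def)
      show "F (\<lambda>\<sigma>. c * ?G \<phi> \<sigma>) = (\<lambda>\<tau>. c * \<phi> \<tau>)"
        unfolding linear_op_scale[OF F G(1)[OF that]] G(2)[OF that] ..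
    qed
  qed
qed

text \<open>Let F \<psi> = \<phi> and let C bound the form of the inverse. Nonnegativity of the form
  at \<phi> - t \<psi> reads 0 \<le> <F \<phi>, \<phi>> - 2 t |\<phi>|^2 + t^2 <\<psi>, \<phi>>, and
  the last product is at most C |\<phi>|^2. The choice t = 1 / C gives coercivity with constant 1 /
  C.\<close>

lemma bij_positive_semidefinite_coercive:
  fixes F :: "('a, real) operator"
  assumes fin: "finite X" and F: "linear_op X X F" and bij: "bij_betw F (ell2 X) (ell2 X)"
    and sym: "\<And>\<phi> \<psi>. \<phi> \<in> ell2 X \<Longrightarrow> \<psi> \<in> ell2 X \<Longrightarrow>
      ell2_inner X (F \<phi>) \<psi> = ell2_inner X \<phi> (F \<psi>)"
    and psd: "\<And>\<phi>. \<phi> \<in> ell2 X \<Longrightarrow> 0 \<le> ell2_inner X (F \<phi>) \<phi>"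
  obtains c where "c > 0"
    and "\<And>\<phi>. \<phi> \<in> ell2 X \<Longrightarrow> c * ell2_inner X \<phi> \<phi> \<le> ell2_inner X (F \<phi>) \<phi>"
proof -
  let ?G = "inv_into (ell2 X) F"
  have G: "?G \<psi> \<in> ell2 X" "F (?G \<psi>) = \<psi>" if "\<psi> \<in> ell2 X" for \<psi>
    using that bij_betw_imp_surj_on[OF bij] inv_into_into[of \<psi> F "ell2 X"]
      f_inv_into_f[of \<psi> F "ell2 X"] by auto
  obtain C0 where C0: "\<And>\<phi>. \<phi> \<in> ell2 X \<Longrightarrow> ell2_inner X (?G \<phi>) \<phi> \<le> C0 * ell2_inner X \<phi> \<phi>"
    using linear_op_quadratic_bound[OF fin linear_op_inverse[OF F bij]] by blast
  \<comment> \<open>The bound \<open>C0\<close> may fail to be positive; the maximum with 1 makes 1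
    / C a legitimate positive constant.\<close>
  define C where "C = max C0 1"
  have C: "C > 0" by (simp add: C_def)
  have "(1 / C) * ell2_inner X \<phi> \<phi> \<le> ell2_inner X (F \<phi>) \<phi>" if \<phi>: "\<phi> \<in> ell2 X" for \<phi>
  proof -
    define t where "t = 1 / C"
    let ?N = "ell2_inner X \<phi> \<phi>"
    let ?\<psi> = "?G \<phi>"
    have t\<psi>: "(\<lambda>\<tau>. t * ?\<psi> \<tau>) \<in> ell2 X" using G(1)[OF \<phi>] by (simp add: ell2_def)
    have d: "(\<lambda>\<tau>. \<phi> \<tau> - t * ?\<psi> \<tau>) \<in> ell2 X" using G(1)[OF \<phi>] \<phi> by (simp add: ell2_def)
    have "F (\<lambda>\<tau>. \<phi> \<tau> - t * ?\<psi> \<tau>) = (\<lambda>\<tau>. F \<phi> \<tau> - t * \<phi> \<tau>)"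
      unfolding linear_op_diff[OF F \<phi> t\<psi>] linear_op_scale[OF F G(1)[OF \<phi>]] G(2)[OF \<phi>] ..
    then have "0 \<le> ell2_inner X (\<lambda>\<tau>. F \<phi> \<tau> - t * \<phi> \<tau>) (\<lambda>\<tau>. \<phi> \<tau> - t * ?\<psi> \<tau>)"
      using psd[OF d] by simp
    also have "\<dots> = ell2_inner X (F \<phi>) \<phi> - t * ?N - t * ell2_inner X (F \<phi>) ?\<psi>
        + t * (t * ell2_inner X \<phi> ?\<psi>)"
      by (simp add: ell2_inner_linear algebra_simps)
    also have "ell2_inner X (F \<phi>) ?\<psi> = ?N"
      using sym[OF \<phi> G(1)[OF \<phi>]] G(2)[OF \<phi>] by simp
    also have "ell2_inner X \<phi> ?\<psi> = ell2_inner X ?\<psi> \<phi>" by (rule ell2_inner_commute)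
    finally have "0 \<le> ell2_inner X (F \<phi>) \<phi> - 2 * (t * ?N) + t * (t * ell2_inner X ?\<psi> \<phi>)" by simp
    moreover have "ell2_inner X ?\<psi> \<phi> \<le> C * ?N"
    proof -
      have "C0 * ?N \<le> C * ?N"
        by (intro mult_right_mono) (auto simp: C_def ell2_inner_self_nonneg)
      then show ?thesis using C0[OF \<phi>] by linarith
    qed
    then have "t * ell2_inner X ?\<psi> \<phi> \<le> ?N"
      using C by (simp add: t_def field_simps)
    then have "t * (t * ell2_inner X ?\<psi> \<phi>) \<le> t * ?N"
      using C by (intro mult_left_mono) (auto simp: t_def)
    ultimately have "t * ?N \<le> ell2_inner X (F \<phi>) \<phi>" by linarith
    then show ?thesis by (simp add: t_def)
  qed
  then show ?thesis using that[of "1 / C"] C by simp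
qed

text \<open>The supremum \<open>L\<close> of the Rayleigh quotients is an eigenvalue: otherwise \<open>L - A\<close> would be
  bijective and hence coercive, so that the quotients would stay away from \<open>L\<close>.\<close>

lemma symmetric_top_eigenvalue:
  fixes A :: "('a, real) operator"
  assumes fin: "finite X" and ne: "X \<noteq> {}" and A: "linear_op X X A"
    and sym: "\<And>\<phi> \<psi>. \<phi> \<in> ell2 X \<Longrightarrow> \<psi> \<in> ell2 X \<Longrightarrow>
      ell2_inner X (A \<phi>) \<psi> = ell2_inner X \<phi> (A \<psi>)"
  obtains L \<phi> where "eigenfunction X A L \<phi>"
    and "\<And>\<psi>. \<psi> \<in> ell2 X \<Longrightarrow> ell2_inner X (A \<psi>) \<psi> \<le> L * ell2_inner X \<psi> \<psi>"
proof -
  define Q where "Q = {ell2_inner X (A \<phi>) \<phi> | \<phi>. \<phi> \<in> ell2 X \<and> ell2_inner X \<phi> \<phi> = 1}"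
  define L where "L = Sup Q"
  obtain C where C: "\<And>\<phi>. \<phi> \<in> ell2 X \<Longrightarrow> ell2_inner X (A \<phi>) \<phi> \<le> C * ell2_inner X \<phi> \<phi>"
    using linear_op_quadratic_bound[OF fin A] by blast
  have bdd: "bdd_above Q"
    using C unfolding Q_def by (intro bdd_aboveI[where M = C]) force
  obtain \<tau>0 where "\<tau>0 \<in> X" using ne by blast
  then have "indicator_fun \<tau>0 \<in> ell2 X" "ell2_inner X (indicator_fun \<tau>0) (indicator_fun \<tau>0) = (1::real)"
    using fin by (auto simp: ell2_def ell2_inner_real indicator_fun_def if_distrib cong: if_cong)
  then have Qne: "Q \<noteq> {}" unfolding Q_def by blast
  have scaled: "ell2_inner X (A \<psi>) \<psi> \<le> M * ell2_inner X \<psi> \<psi>"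
    if M: "\<And>q. q \<in> Q \<Longrightarrow> q \<le> M" and \<psi>: "\<psi> \<in> ell2 X" for M \<psi>
  proof (cases "\<psi> = (\<lambda>_. 0)")
    case True
    then show ?thesis using linear_op_zero[OF A] by (simp add: ell2_inner_real)
  next
    case False
    let ?N = "ell2_inner X \<psi> \<psi>"
    have N: "?N > 0" by (rule ell2_inner_self_pos[OF fin \<psi> False])
    define r where "r = 1 / sqrt ?N"
    have r: "r * r = 1 / ?N" using N by (simp add: r_def)
    have "(\<lambda>\<tau>. r * \<psi> \<tau>) \<in> ell2 X" using \<psi> by (simp add: ell2_def)
    moreover have "ell2_inner X (\<lambda>\<tau>. r * \<psi> \<tau>) (\<lambda>\<tau>. r * \<psi> \<tau>) = 1"
      using N r by (simp add: ell2_inner_linear flip: mult.assoc)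
    moreover have "ell2_inner X (A (\<lambda>\<tau>. r * \<psi> \<tau>)) (\<lambda>\<tau>. r * \<psi> \<tau>) = ell2_inner X (A \<psi>) \<psi> / ?N"
      unfolding linear_op_scale[OF A \<psi>] using r by (simp add: ell2_inner_linear flip: mult.assoc)
    ultimately have "ell2_inner X (A \<psi>) \<psi> / ?N \<in> Q" unfolding Q_def by force
    from M[OF this] show ?thesis using N by (simp add: field_simps)
  qed
  have LQ: "q \<le> L" if "q \<in> Q" for q unfolding L_def using that bdd by (rule cSup_upper)
  note bound = scaled[OF LQ]
  have "\<exists>\<phi>. eigenfunction X A L \<phi>"
  proof (rule ccontr)
    assume no: "\<not> (\<exists>\<phi>. eigenfunction X A L \<phi>)"
    define F where "F \<phi> \<tau> = L * \<phi> \<tau> - A \<phi> \<tau>" for \<phi> \<tau>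
    have F: "linear_op X X F"
      using A unfolding linear_op_def F_def by (auto simp: ell2_def algebra_simps fun_eq_iff)
    have FX: "ell2_inner X (F \<phi>) \<psi> = L * ell2_inner X \<phi> \<psi> - ell2_inner X (A \<phi>) \<psi>" for \<phi> \<psi>
      unfolding F_def by (simp add: ell2_inner_linear)
    have bij: "bij_betw F (ell2 X) (ell2 X)"
    proof (rule linear_op_trivial_kernel_bij[OF fin F])
      fix \<phi> assume \<phi>: "\<phi> \<in> ell2 X" "F \<phi> = (\<lambda>_. 0)"
      then have "A \<phi> = (\<lambda>\<tau>. L * \<phi> \<tau>)" by (simp add: F_def fun_eq_iff)
      with no \<phi> show "\<phi> = (\<lambda>_. 0)" unfolding eigenfunction_def by blast
    qed
    obtain c where c: "c > 0"
      "\<And>\<phi>. \<phi> \<in> ell2 X \<Longrightarrow> c * ell2_inner X \<phi> \<phi> \<le> ell2_inner X (F \<phi>) \<phi>"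
    proof (rule bij_positive_semidefinite_coercive[OF fin F bij])
      show "ell2_inner X (F \<phi>) \<psi> = ell2_inner X \<phi> (F \<psi>)"
        if "\<phi> \<in> ell2 X" "\<psi> \<in> ell2 X" for \<phi> \<psi>
        using sym[OF that] FX[of \<phi> \<psi>] FX[of \<psi> \<phi>]
        by (simp add: ell2_inner_commute[of X \<phi>])
      show "0 \<le> ell2_inner X (F \<phi>) \<phi>" if "\<phi> \<in> ell2 X" for \<phi>
        using bound[OF _ that] by (simp add: FX)
    qed (rule that)
    have "Sup Q \<le> L - c"
    proof (rule cSup_least[OF Qne])
      fix q assume "q \<in> Q"
      then obtain \<phi> where "\<phi> \<in> ell2 X" "ell2_inner X \<phi> \<phi> = 1" "q = ell2_inner X (A \<phi>) \<phi>"
        unfolding Q_def by blast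
      then show "q \<le> L - c" using c(2)[of \<phi>] by (simp add: FX)
    qed
    with c(1) show False by (simp add: L_def)
  qed
  then show ?thesis using that bound by blast
qed

lemma eigenvalue_Rayleigh:
  fixes A :: "('a, real) operator"
  assumes "eigenfunction X A z \<phi>"
  shows "ell2_inner X (A \<phi>) \<phi> = z * ell2_inner X \<phi> \<phi>"
  using assms by (simp add: eigenfunction_def ell2_inner_linear)

lemma eigenfunction_pos:
  fixes A :: "('a, real) operator"
  assumes "finite X" "eigenfunction X A z \<phi>"
  shows "0 < ell2_inner X \<phi> \<phi>"
  using assms by (auto simp: eigenfunction_def intro: ell2_inner_self_pos)

text \<open>Every eigenvalue is the Rayleigh quotient of its eigenfunction and therefore at most
  \<open>L\<close>, which is itself an eigenvalue. The first conclusion later supplies functions to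
  insert, the second bounds the form at arbitrary test functions.\<close>

lemma Max_spectrum_symmetric:
  fixes A :: "('a, real) operator"
  assumes fin: "finite X" and ne: "X \<noteq> {}" and A: "linear_op X X A"
    and sym: "\<And>\<phi> \<psi>. \<phi> \<in> ell2 X \<Longrightarrow> \<psi> \<in> ell2 X \<Longrightarrow>
      ell2_inner X (A \<phi>) \<psi> = ell2_inner X \<phi> (A \<psi>)"
  shows "\<exists>\<phi>. eigenfunction X A (Max (spectrum_op X A)) \<phi>"
    and "\<psi> \<in> ell2 X \<Longrightarrow>
      ell2_inner X (A \<psi>) \<psi> \<le> Max (spectrum_op X A) * ell2_inner X \<psi> \<psi>"
proof -
  obtain L \<phi> where L: "eigenfunction X A L \<phi>"
    "\<And>\<psi>. \<psi> \<in> ell2 X \<Longrightarrow> ell2_inner X (A \<psi>) \<psi> \<le> L * ell2_inner X \<psi> \<psi>"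
    by (rule symmetric_top_eigenvalue[OF fin ne A sym]) auto
  have "Max (spectrum_op X A) = L"
    unfolding spectrum_op_eigenfunction[OF fin A]
  proof (rule Max_eqI[OF finite_eigenvalues[OF fin A]])
    fix z assume "z \<in> {z. \<exists>\<phi>. eigenfunction X A z \<phi>}"
    then obtain \<psi> where \<psi>: "eigenfunction X A z \<psi>" by blast
    then have "z * ell2_inner X \<psi> \<psi> \<le> L * ell2_inner X \<psi> \<psi>"
      using L(2)[of \<psi>] eigenvalue_Rayleigh[OF \<psi>] by (simp add: eigenfunction_def)
    then show "z \<le> L" using eigenfunction_pos[OF fin \<psi>] by simp
  qed (use L(1) in blast)
  with L show "\<exists>\<phi>. eigenfunction X A (Max (spectrum_op X A)) \<phi>"
    and "\<psi> \<in> ell2 X \<Longrightarrow>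
      ell2_inner X (A \<psi>) \<psi> \<le> Max (spectrum_op X A) * ell2_inner X \<psi> \<psi>"
    by auto
qed

lemma Min_spectrum_symmetric:
  fixes A :: "('a, real) operator"
  assumes fin: "finite X" and ne: "X \<noteq> {}" and A: "linear_op X X A"
    and sym: "\<And>\<phi> \<psi>. \<phi> \<in> ell2 X \<Longrightarrow> \<psi> \<in> ell2 X \<Longrightarrow>
      ell2_inner X (A \<phi>) \<psi> = ell2_inner X \<phi> (A \<psi>)"
  shows "\<exists>\<phi>. eigenfunction X A (Min (spectrum_op X A)) \<phi>"
    and "\<psi> \<in> ell2 X \<Longrightarrow>
      Min (spectrum_op X A) * ell2_inner X \<psi> \<psi> \<le> ell2_inner X (A \<psi>) \<psi>"
proof -
  \<comment> \<open>The bottom of the spectrum of \<open>A\<close> is the negated top of that of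
    -\<open>A\<close>. The explicit factor -1 lets the scaling rules for \<open>ell2_inner\<close>
    apply.\<close>
  define B where "B \<phi> = (\<lambda>\<tau>. - 1 * A \<phi> \<tau>)" for \<phi>
  have B: "linear_op X X B"
    using A unfolding linear_op_def B_def by (auto simp: ell2_def algebra_simps fun_eq_iff)
  have symB: "ell2_inner X (B \<phi>) \<psi> = ell2_inner X \<phi> (B \<psi>)"
    if "\<phi> \<in> ell2 X" "\<psi> \<in> ell2 X" for \<phi> \<psi>
    unfolding B_def ell2_inner_linear sym[OF that] ..
  obtain L \<phi> where L: "eigenfunction X B L \<phi>"
    "\<And>\<psi>. \<psi> \<in> ell2 X \<Longrightarrow> ell2_inner X (B \<psi>) \<psi> \<le> L * ell2_inner X \<psi> \<psi>"
    by (rule symmetric_top_eigenvalue[OF fin ne B symB]) auto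
  have e: "eigenfunction X A (- L) \<phi>"
    using L(1) by (auto simp: eigenfunction_def B_def fun_eq_iff)
      (metis minus_equation_iff)
  have b: "- L * ell2_inner X \<psi> \<psi> \<le> ell2_inner X (A \<psi>) \<psi>" if "\<psi> \<in> ell2 X" for \<psi>
    using L(2)[OF that] unfolding B_def ell2_inner_linear by simp
  have "Min (spectrum_op X A) = - L"
    unfolding spectrum_op_eigenfunction[OF fin A]
  proof (rule Min_eqI[OF finite_eigenvalues[OF fin A]])
    fix z assume "z \<in> {z. \<exists>\<phi>. eigenfunction X A z \<phi>}"
    then obtain \<psi> where \<psi>: "eigenfunction X A z \<psi>" by blast
    then have "- L * ell2_inner X \<psi> \<psi> \<le> z * ell2_inner X \<psi> \<psi>"
      using b[of \<psi>] eigenvalue_Rayleigh[OF \<psi>] by (simp add: eigenfunction_def)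
    then show "- L \<le> z"
      using eigenfunction_pos[OF fin \<psi>] by (simp only: mult_le_cancel_right_pos)
  qed (use e in blast)
  with e b show "\<exists>\<phi>. eigenfunction X A (Min (spectrum_op X A)) \<phi>"
    and "\<psi> \<in> ell2 X \<Longrightarrow>
      Min (spectrum_op X A) * ell2_inner X \<psi> \<psi> \<le> ell2_inner X (A \<psi>) \<psi>"
    by auto
qed

section \<open>The full simplex\<close>

text \<open>Allows all inner products to be taken over \<open>Pow V\<close>, independently of the
  dimension, so that the operators on the full simplex need no grading.\<close>

lemma ell2_inner_superset:
  fixes \<phi> :: "'a set \<Rightarrow> real"
  assumes "finite Y" "X \<subseteq> Y" "\<phi> \<in> ell2 X"
  shows "ell2_inner X \<phi> \<psi> = ell2_inner Y \<phi> \<psi>"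
  unfolding ell2_inner_real using assms by (intro sum.mono_neutral_left) (auto simp: ell2_def)

lemma ell2_inner_sum_right:
  "ell2_inner X \<chi> (\<lambda>\<tau>. \<Sum>v\<in>I. g v \<tau>) = (\<Sum>v\<in>I. ell2_inner X \<chi> (g v))"
  for \<chi> :: "'a set \<Rightarrow> real"
  unfolding ell2_inner_real by (simp add: sum_distrib_left sum.swap[of _ I])

lemma ell2_inner_restr:
  fixes \<phi> :: "'a set \<Rightarrow> real"
  assumes "\<psi> \<in> ell2 Z"
  shows "ell2_inner X (restr Z \<phi>) \<psi> = ell2_inner X \<phi> \<psi>"
  unfolding ell2_inner_real using assms by (intro sum.cong) (auto simp: restr_def ell2_def)

text \<open>Double counting of incidences: pairs of a simplex and one of its vertices correspond to
  pairs of a simplex and a vertex outside it. Both the adjointness of \<open>full_cobd\<close> and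
  \<open>full_bd\<close> and the facet counts rest on it.\<close>

lemma sum_remove_insert:
  assumes "finite V"
  shows "(\<Sum>\<sigma>\<in>Pow V. \<Sum>v\<in>\<sigma>. f (\<sigma> - {v}) \<sigma> v) = (\<Sum>\<tau>\<in>Pow V. \<Sum>v\<in>V - \<tau>. f \<tau> (insert v \<tau>) v)"
proof -
  have fin: "finite \<sigma>" if "\<sigma> \<in> Pow V" for \<sigma> using that assms finite_subset by auto
  have "(\<Sum>\<sigma>\<in>Pow V. \<Sum>v\<in>\<sigma>. f (\<sigma> - {v}) \<sigma> v) = (\<Sum>(\<sigma>, v)\<in>Sigma (Pow V) (\<lambda>\<sigma>. \<sigma>). f (\<sigma> - {v}) \<sigma> v)"
    using assms fin by (intro sum.Sigma) auto
  also have "\<dots> = (\<Sum>(\<tau>, v)\<in>Sigma (Pow V) (\<lambda>\<tau>. V - \<tau>). f \<tau> (insert v \<tau>) v)"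
    by (rule sum.reindex_bij_witness[where i = "\<lambda>(\<tau>, v). (insert v \<tau>, v)"
          and j = "\<lambda>(\<sigma>, v). (\<sigma> - {v}, v)"]) (auto simp: insert_absorb)
  also have "\<dots> = (\<Sum>\<tau>\<in>Pow V. \<Sum>v\<in>V - \<tau>. f \<tau> (insert v \<tau>) v)"
    using assms by (intro sum.Sigma[symmetric]) auto
  finally show ?thesis .
qed

text \<open>The four numbers are the signs along the square of simplices between \<rho> and \<rho>
  with two vertices added. Signs are their own inverses, so the anticommutation relation can be
  solved for another pair of edges.\<close>

lemma sign_square_cancel:
  fixes a b c d :: int
  assumes "c * a = - (b * d)" "b * b = 1" "a * a = 1"
  shows "a * d = - (c * b)"
proof -
  have bd: "b * d = - (c * a)" using assms(1) by simp
  have "a * d = a * b * (b * d)" using assms(2) by (simp add: mult.assoc flip: mult.assoc[of b b])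
  also have "\<dots> = - (c * b * (a * a))" unfolding bd by (simp add: mult_ac)
  finally show ?thesis by (simp only: assms(3) mult_1_right)
qed

text \<open>The two sign conditions encode that incidence coefficients are units and that the
  coboundary squares to zero, read off at each pair of simplices differing by two vertices. Integer
  signs can act on real and on complex functions alike.\<close>

locale signed_simplex =
  fixes V :: "'a set" and s :: "'a set \<Rightarrow> 'a set \<Rightarrow> int"
  assumes finite_V: "finite V"
    and sign_square: "\<sigma> \<subseteq> V \<Longrightarrow> v \<in> \<sigma> \<Longrightarrow> s (\<sigma> - {v}) \<sigma> * s (\<sigma> - {v}) \<sigma> = 1"
    and sign_anticommute: "\<tau> \<subseteq> V \<Longrightarrow> v \<in> V - \<tau> \<Longrightarrow> w \<in> V - \<tau> \<Longrightarrow> v \<noteq> w \<Longrightarrow>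
      s \<tau> (insert v \<tau>) * s (insert v \<tau>) (insert w (insert v \<tau>)) =
      - (s \<tau> (insert w \<tau>) * s (insert w \<tau>) (insert v (insert w \<tau>)))"
begin

text \<open>The augmented coboundary of the full simplex, acting on functions of all dimensions at
  once.\<close>

definition full_cobd :: "('a set \<Rightarrow> 'f::comm_ring_1) \<Rightarrow> 'a set \<Rightarrow> 'f" where
  "full_cobd \<phi> \<sigma> = (if \<sigma> \<subseteq> V then \<Sum>v\<in>\<sigma>. of_int (s (\<sigma> - {v}) \<sigma>) * \<phi> (\<sigma> - {v}) else 0)"

definition full_bd :: "('a set \<Rightarrow> 'f::comm_ring_1) \<Rightarrow> 'a set \<Rightarrow> 'f" where
  "full_bd \<psi> \<tau> = (if \<tau> \<subseteq> V then \<Sum>v\<in>V - \<tau>. of_int (s \<tau> (insert v \<tau>)) * \<psi> (insert v \<tau>) else 0)"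

definition contract :: "'a \<Rightarrow> ('a set \<Rightarrow> 'f::comm_ring_1) \<Rightarrow> 'a set \<Rightarrow> 'f" where
  "contract v \<psi> \<tau> = (if \<tau> \<subseteq> V \<and> v \<notin> \<tau> then of_int (s \<tau> (insert v \<tau>)) * \<psi> (insert v \<tau>) else 0)"

abbreviation inner_V :: "('a set \<Rightarrow> real) \<Rightarrow> ('a set \<Rightarrow> real) \<Rightarrow> real" where
  "inner_V \<equiv> ell2_inner (Pow V)"

abbreviation norm2 :: "('a set \<Rightarrow> real) \<Rightarrow> real" where
  "norm2 \<phi> \<equiv> inner_V \<phi> \<phi>"

lemma sign_square': "\<tau> \<subseteq> V \<Longrightarrow> v \<in> V - \<tau> \<Longrightarrow> s \<tau> (insert v \<tau>) * s \<tau> (insert v \<tau>) = 1"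
  using sign_square[of "insert v \<tau>" v] by simp

lemma norm2_sum: "norm2 \<phi> = (\<Sum>\<tau>\<in>Pow V. (\<phi> \<tau>)\<^sup>2)"
  by (simp add: ell2_inner_real power2_eq_square)

lemma norm2_nonneg: "0 \<le> norm2 \<phi>"
  by (rule ell2_inner_self_nonneg)

text \<open>The full simplex is a cone with apex \<open>v\<close>, and this is its contracting
  homotopy. If \<open>v\<close> lies in \<tau>, only the facet without \<open>v\<close> contributes,
  with a squared sign. Otherwise the term of the coboundary that removes \<open>v\<close> returns
  \<phi> \<tau>, and the terms for the other vertices cancel against the second summand by
  anticommutation.\<close>

lemma contract_full_cobd:
  fixes \<phi> :: "'a set \<Rightarrow> 'f::comm_ring_1"
  assumes "\<tau> \<subseteq> V" "v \<in> V"
  shows "contract v (full_cobd \<phi>) \<tau> + full_cobd (contract v \<phi>) \<tau> = \<phi> \<tau>"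
proof (cases "v \<in> \<tau>")
  case True
  have fin: "finite \<tau>" using assms finite_V finite_subset by blast
  have "full_cobd (contract v \<phi>) \<tau> =
      (\<Sum>w\<in>\<tau>. of_int (s (\<tau> - {w}) \<tau>) * contract v \<phi> (\<tau> - {w}))"
    using assms by (simp add: full_cobd_def)
  also have "\<dots> = (\<Sum>w\<in>\<tau>. if w = v then \<phi> \<tau> else 0)"
  proof (rule sum.cong)
    fix w assume "w \<in> \<tau>"
    have "of_int (s (\<tau> - {v}) \<tau>) * (of_int (s (\<tau> - {v}) \<tau>) * \<phi> \<tau>) = of_int 1 * \<phi> \<tau>"
      unfolding sign_square[OF assms(1) True, symmetric] by (simp add: mult.assoc)
    then show "of_int (s (\<tau> - {w}) \<tau>) * contract v \<phi> (\<tau> - {w}) = (if w = v then \<phi> \<tau> else 0)"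
      using True assms by (auto simp: contract_def insert_absorb)
  qed simp
  also have "\<dots> = \<phi> \<tau>" using fin True by simp
  finally show ?thesis using True by (simp add: contract_def)
next
  case False
  have fin: "finite \<tau>" using assms finite_V finite_subset by blast
  let ?\<sigma> = "insert v \<tau>"
  let ?a = "s \<tau> ?\<sigma>"
  have \<sigma>: "?\<sigma> \<subseteq> V" using assms by simp
  have a: "?a * ?a = 1" using sign_square'[OF assms(1)] assms(2) False by blast
  have "contract v (full_cobd \<phi>) \<tau> =
      of_int ?a * (\<Sum>w\<in>?\<sigma>. of_int (s (?\<sigma> - {w}) ?\<sigma>) * \<phi> (?\<sigma> - {w}))"
    using False assms by (simp add: contract_def full_cobd_def)
  also have "\<dots> = of_int (?a * ?a) * \<phi> \<tau>
      + (\<Sum>w\<in>\<tau>. of_int (?a * s (?\<sigma> - {w}) ?\<sigma>) * \<phi> (?\<sigma> - {w}))"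
    using False fin by (simp add: sum_distrib_left algebra_simps)
  also have "(\<Sum>w\<in>\<tau>. of_int (?a * s (?\<sigma> - {w}) ?\<sigma>) * \<phi> (?\<sigma> - {w})) = - full_cobd (contract v \<phi>) \<tau>"
  proof -
    have "of_int (?a * s (?\<sigma> - {w}) ?\<sigma>) * \<phi> (?\<sigma> - {w}) =
        - (of_int (s (\<tau> - {w}) \<tau>) * contract v \<phi> (\<tau> - {w}))" if w: "w \<in> \<tau>" for w
    proof -
      let ?\<rho> = "\<tau> - {w}"
      have vw: "v \<noteq> w" using w False by blast
      have i: "insert w ?\<rho> = \<tau>" "insert w (insert v ?\<rho>) = ?\<sigma>" "?\<sigma> - {w} = insert v ?\<rho>"
        using w vw by auto
      have "s ?\<rho> \<tau> * ?a = - (s ?\<rho> (insert v ?\<rho>) * s (insert v ?\<rho>) ?\<sigma>)"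
        using sign_anticommute[of ?\<rho> w v, unfolded i] assms w vw False by blast
      moreover have "s ?\<rho> (insert v ?\<rho>) * s ?\<rho> (insert v ?\<rho>) = 1"
        using sign_square'[of ?\<rho> v] assms False by blast
      ultimately have "?a * s (insert v ?\<rho>) ?\<sigma> = - (s ?\<rho> \<tau> * s ?\<rho> (insert v ?\<rho>))"
        using a by (rule sign_square_cancel)
      then have "of_int (?a * s (insert v ?\<rho>) ?\<sigma>) =
          (of_int (- (s ?\<rho> \<tau> * s ?\<rho> (insert v ?\<rho>))) :: 'f)" by simp
      then show ?thesis
        using assms False unfolding i contract_def by (simp add: subset_iff mult.assoc)
    qed
    then show ?thesis using assms by (simp add: full_cobd_def sum_negf)
  qed
  finally show ?thesis unfolding a by simp
qed

text \<open>Contractions with distinct vertices anticommute, contracting twice with the same vertex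
  gives zero, and \<open>full_bd\<close> is the sum of all contractions.\<close>

lemma full_bd_contract:
  fixes \<phi> :: "'a set \<Rightarrow> 'f::comm_ring_1"
  assumes "v \<in> V"
  shows "full_bd (contract v \<phi>) \<tau> = - contract v (full_bd \<phi>) \<tau>"
proof (cases "\<tau> \<subseteq> V \<and> v \<notin> \<tau>")
  case True
  then have \<tau>: "\<tau> \<subseteq> V" "v \<in> V - \<tau>" using assms by auto
  have "full_bd (contract v \<phi>) \<tau> =
      (\<Sum>w\<in>V - \<tau>. of_int (s \<tau> (insert w \<tau>)) * contract v \<phi> (insert w \<tau>))"
    using \<tau> by (simp add: full_bd_def)
  also have "\<dots> = (\<Sum>w\<in>V - insert v \<tau>. of_int (s \<tau> (insert w \<tau>)) * contract v \<phi> (insert w \<tau>))"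
    using \<tau> finite_V by (intro sum.mono_neutral_right) (auto simp: contract_def)
  also have "\<dots> = (\<Sum>w\<in>V - insert v \<tau>. - (of_int (s \<tau> (insert v \<tau>)) *
      (of_int (s (insert v \<tau>) (insert w (insert v \<tau>))) * \<phi> (insert w (insert v \<tau>)))))"
  proof (rule sum.cong)
    fix w assume w: "w \<in> V - insert v \<tau>"
    have "of_int (s \<tau> (insert v \<tau>) * s (insert v \<tau>) (insert w (insert v \<tau>))) =
      (of_int (- (s \<tau> (insert w \<tau>) * s (insert w \<tau>) (insert v (insert w \<tau>)))) :: 'f)"
      using sign_anticommute[of \<tau> v w] \<tau> w by (intro arg_cong[where f = of_int]) auto
    then show "of_int (s \<tau> (insert w \<tau>)) * contract v \<phi> (insert w \<tau>) =
        - (of_int (s \<tau> (insert v \<tau>)) *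
      (of_int (s (insert v \<tau>) (insert w (insert v \<tau>))) * \<phi> (insert w (insert v \<tau>))))"
      using w \<tau> by (auto simp: contract_def insert_commute simp flip: mult.assoc)
  qed simp
  also have "\<dots> = - contract v (full_bd \<phi>) \<tau>"
    using \<tau> by (simp add: contract_def full_bd_def sum_negf sum_distrib_left)
  finally show ?thesis .
next
  case False
  then show ?thesis by (auto simp: full_bd_def contract_def intro!: sum.neutral)
qed

lemma full_bd_eq_sum_contract: "full_bd \<phi> = (\<lambda>\<tau>. \<Sum>v\<in>V. contract v \<phi> \<tau>)"
proof
  fix \<tau>
  show "full_bd \<phi> \<tau> = (\<Sum>v\<in>V. contract v \<phi> \<tau>)"
  proof (cases "\<tau> \<subseteq> V")
    case True
    then have "(\<Sum>v\<in>V. contract v \<phi> \<tau>) = (\<Sum>v\<in>V - \<tau>. contract v \<phi> \<tau>)"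
      using finite_V by (intro sum.mono_neutral_right) (auto simp: contract_def)
    then show ?thesis using True by (simp add: full_bd_def contract_def)
  qed (simp add: full_bd_def contract_def)
qed

lemma full_cobd_sum: "full_cobd (\<lambda>\<tau>. \<Sum>v\<in>I. g v \<tau>) \<sigma> = (\<Sum>v\<in>I. full_cobd (g v) \<sigma>)"
  by (auto simp: full_cobd_def sum_distrib_left intro: sum.swap)

lemma full_bd_sum: "full_bd (\<lambda>\<tau>. \<Sum>v\<in>I. g v \<tau>) \<sigma> = (\<Sum>v\<in>I. full_bd (g v) \<sigma>)"
  by (auto simp: full_bd_def sum_distrib_left intro: sum.swap)

text \<open>Writing the inner boundary as a sum of contractions and moving each one outside shows
  that the squared boundary is its own negative.\<close>

lemma full_bd_full_bd:
  fixes \<phi> :: "'a set \<Rightarrow> real"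
  shows "full_bd (full_bd \<phi>) = (\<lambda>_. 0)"
proof
  fix \<tau>
  have "full_bd (full_bd \<phi>) \<tau> = (\<Sum>v\<in>V. full_bd (contract v \<phi>) \<tau>)"
    by (subst full_bd_eq_sum_contract[of \<phi>]) (rule full_bd_sum)
  also have "\<dots> = (\<Sum>v\<in>V. - contract v (full_bd \<phi>) \<tau>)"
    by (intro sum.cong full_bd_contract) auto
  also have "\<dots> = - full_bd (full_bd \<phi>) \<tau>"
    by (subst (2) full_bd_eq_sum_contract) (simp add: sum_negf)
  finally show "full_bd (full_bd \<phi>) \<tau> = 0" by simp
qed

text \<open>Kept bilinear over a commutative ring: the sesquilinear version arises by inserting the
  conjugate of \<psi>.\<close>

lemma full_cobd_adjoint_sum:
  fixes \<phi> \<psi> :: "'a set \<Rightarrow> 'f::comm_ring_1"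
  shows "(\<Sum>\<sigma>\<in>Pow V. full_cobd \<phi> \<sigma> * \<psi> \<sigma>) = (\<Sum>\<tau>\<in>Pow V. \<phi> \<tau> * full_bd \<psi> \<tau>)"
proof -
  have "(\<Sum>\<sigma>\<in>Pow V. full_cobd \<phi> \<sigma> * \<psi> \<sigma>) =
      (\<Sum>\<sigma>\<in>Pow V. \<Sum>v\<in>\<sigma>. of_int (s (\<sigma> - {v}) \<sigma>) * \<phi> (\<sigma> - {v}) * \<psi> \<sigma>)"
    by (simp add: full_cobd_def sum_distrib_right)
  also have "\<dots> = (\<Sum>\<tau>\<in>Pow V. \<Sum>v\<in>V - \<tau>. of_int (s \<tau> (insert v \<tau>)) * \<phi> \<tau> * \<psi> (insert v \<tau>))"
    by (rule sum_remove_insert[OF finite_V])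
  also have "\<dots> = (\<Sum>\<tau>\<in>Pow V. \<phi> \<tau> * full_bd \<psi> \<tau>)"
    by (simp add: full_bd_def sum_distrib_left mult_ac)
  finally show ?thesis .
qed

lemma full_cobd_adjoint: "inner_V (full_cobd \<phi>) \<psi> = inner_V \<phi> (full_bd \<psi>)"
  unfolding ell2_inner_real by (rule full_cobd_adjoint_sum)

text \<open>Expresses that the Hodge Laplacian of the full simplex is multiplication by the number
  of vertices: the homotopy identity is paired with \<phi> and summed over \<open>V\<close>.\<close>

lemma norm2_full_cobd_full_bd:
  "norm2 (full_cobd \<phi>) + norm2 (full_bd \<phi>) = real (card V) * norm2 \<phi>"
proof -
  have "norm2 (full_cobd \<phi>) + norm2 (full_bd \<phi>) =
      (\<Sum>v\<in>V. inner_V \<phi> (contract v (full_cobd \<phi>)) + inner_V \<phi> (full_cobd (contract v \<phi>)))"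
  proof -
    have "norm2 (full_bd \<phi>) = inner_V \<phi> (full_cobd (full_bd \<phi>))"
      using full_cobd_adjoint[of "full_bd \<phi>" \<phi>] by (simp add: ell2_inner_commute)
    also have "full_cobd (full_bd \<phi>) = (\<lambda>\<tau>. \<Sum>v\<in>V. full_cobd (contract v \<phi>) \<tau>)"
      by (subst full_bd_eq_sum_contract) (simp add: full_cobd_sum fun_eq_iff)
    finally have 1: "norm2 (full_bd \<phi>) = (\<Sum>v\<in>V. inner_V \<phi> (full_cobd (contract v \<phi>)))"
      by (simp add: ell2_inner_sum_right)
    have 2: "norm2 (full_cobd \<phi>) = (\<Sum>v\<in>V. inner_V \<phi> (contract v (full_cobd \<phi>)))"
      unfolding full_cobd_adjoint by (subst full_bd_eq_sum_contract) (rule ell2_inner_sum_right)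
    show ?thesis unfolding 1 2 by (simp add: sum.distrib)
  qed
  also have "\<dots> = (\<Sum>v\<in>V. norm2 \<phi>)"
  proof (rule sum.cong)
    fix v assume v: "v \<in> V"
    show "inner_V \<phi> (contract v (full_cobd \<phi>)) + inner_V \<phi> (full_cobd (contract v \<phi>)) = norm2 \<phi>"
      unfolding ell2_inner_real sum.distrib[symmetric] distrib_left[symmetric]
      by (intro sum.cong) (use contract_full_cobd[OF _ v] in auto)
  qed simp
  finally show ?thesis by simp
qed

section \<open>Facet counts and sums of squared norms over all contractions\<close>

definition facets_in :: "'a set set \<Rightarrow> 'a set \<Rightarrow> nat" where
  "facets_in X \<sigma> = card {w \<in> \<sigma>. \<sigma> - {w} \<in> X}"

text \<open>Signs disappear on squaring, so the square of \<psi> at \<sigma> is counted once for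
  each vertex whose removal lands in \<open>X\<close>.\<close>

lemma sum_norm2_restr_contract:
  "(\<Sum>v\<in>V. norm2 (restr X (contract v \<psi>))) = (\<Sum>\<sigma>\<in>Pow V. real (facets_in X \<sigma>) * (\<psi> \<sigma>)\<^sup>2)"
proof -
  have "(\<Sum>v\<in>V. norm2 (restr X (contract v \<psi>))) =
      (\<Sum>\<tau>\<in>Pow V. \<Sum>v\<in>V. (restr X (contract v \<psi>) \<tau>)\<^sup>2)"
    unfolding norm2_sum by (rule sum.swap)
  also have "\<dots> = (\<Sum>\<tau>\<in>Pow V. \<Sum>v\<in>V - \<tau>. if \<tau> \<in> X then (\<psi> (insert v \<tau>))\<^sup>2 else 0)"
  proof (rule sum.cong)
    fix \<tau> assume \<tau>: "\<tau> \<in> Pow V"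
    have "(\<Sum>v\<in>V. (restr X (contract v \<psi>) \<tau>)\<^sup>2) = (\<Sum>v\<in>V - \<tau>. (restr X (contract v \<psi>) \<tau>)\<^sup>2)"
      using finite_V by (intro sum.mono_neutral_right) (auto simp: contract_def restr_def)
    also have "\<dots> = (\<Sum>v\<in>V - \<tau>. if \<tau> \<in> X then (\<psi> (insert v \<tau>))\<^sup>2 else 0)"
    proof (rule sum.cong)
      fix v assume v: "v \<in> V - \<tau>"
      have "(real_of_int (s \<tau> (insert v \<tau>)))\<^sup>2 = of_int (s \<tau> (insert v \<tau>) * s \<tau> (insert v \<tau>))"
        by (simp add: power2_eq_square)
      also have "\<dots> = 1" using sign_square'[OF _ v] \<tau> by simp
      finally show "(restr X (contract v \<psi>) \<tau>)\<^sup>2 = (if \<tau> \<in> X then (\<psi> (insert v \<tau>))\<^sup>2 else 0)"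
        using v \<tau> by (simp add: restr_def contract_def power_mult_distrib)
    qed simp
    finally show "(\<Sum>v\<in>V. (restr X (contract v \<psi>) \<tau>)\<^sup>2) =
        (\<Sum>v\<in>V - \<tau>. if \<tau> \<in> X then (\<psi> (insert v \<tau>))\<^sup>2 else 0)" .
  qed simp
  also have "\<dots> = (\<Sum>\<sigma>\<in>Pow V. \<Sum>v\<in>\<sigma>. if \<sigma> - {v} \<in> X then (\<psi> \<sigma>)\<^sup>2 else 0)"
    by (rule sum_remove_insert[OF finite_V, symmetric])
  also have "\<dots> = (\<Sum>\<sigma>\<in>Pow V. real (facets_in X \<sigma>) * (\<psi> \<sigma>)\<^sup>2)"
  proof (rule sum.cong)
    fix \<sigma> assume "\<sigma> \<in> Pow V"
    then have "finite \<sigma>" using finite_V finite_subset by blast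
    then show "(\<Sum>v\<in>\<sigma>. if \<sigma> - {v} \<in> X then (\<psi> \<sigma>)\<^sup>2 else 0) = real (facets_in X \<sigma>) * (\<psi> \<sigma>)\<^sup>2"
      by (simp add: sum.If_cases facets_in_def Int_def)
  qed simp
  finally show ?thesis .
qed

lemma sum_norm2_contract:
  "(\<Sum>v\<in>V. norm2 (contract v \<psi>)) = (\<Sum>\<sigma>\<in>Pow V. real (card \<sigma>) * (\<psi> \<sigma>)\<^sup>2)"
proof -
  have "restr (Pow V) (contract v \<psi>) = contract v \<psi>" for v
    by (rule restr_id) (simp add: ell2_def contract_def)
  moreover have "facets_in (Pow V) \<sigma> = card \<sigma>" if "\<sigma> \<in> Pow V" for \<sigma>
    unfolding facets_in_def by (rule arg_cong[of _ _ card]) (use that in auto)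
  ultimately show ?thesis using sum_norm2_restr_contract[of "Pow V" \<psi>] by simp
qed

text \<open>By the homotopy identity the coboundary of \<open>contract v \<phi>\<close> is, on
  \<open>X\<close>, the difference of \<phi> and the contraction of \<open>full_cobd \<phi>\<close>.
  Expanding the square, the mixed terms sum to minus twice the squared norm of
  \<open>full_cobd \<phi>\<close>, which explains the 2; the squares of the contractions give the
  facet counts.\<close>

lemma sum_norm2_cobd_contract:
  assumes "X \<subseteq> Pow V" "\<phi> \<in> ell2 X"
  shows "(\<Sum>v\<in>V. norm2 (restr X (full_cobd (contract v \<phi>)))) =
    real (card V) * norm2 \<phi> + (\<Sum>\<sigma>\<in>Pow V. (real (facets_in X \<sigma>) - 2) * (full_cobd \<phi> \<sigma>)\<^sup>2)"
proof -
  have "norm2 (restr X (full_cobd (contract v \<phi>))) = norm2 \<phi>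
      - 2 * inner_V \<phi> (contract v (full_cobd \<phi>)) + norm2 (restr X (contract v (full_cobd \<phi>)))"
    if v: "v \<in> V" for v
  proof -
    let ?g = "restr X (contract v (full_cobd \<phi>))"
    have "restr X (full_cobd (contract v \<phi>)) = (\<lambda>\<tau>. \<phi> \<tau> - ?g \<tau>)"
    proof
      fix \<tau>
      show "restr X (full_cobd (contract v \<phi>)) \<tau> = \<phi> \<tau> - ?g \<tau>"
        using contract_full_cobd[of \<tau> v \<phi>] v assms
        by (cases "\<tau> \<in> X") (auto simp: restr_def ell2_def algebra_simps)
    qed
    moreover have "inner_V ?g \<phi> = inner_V \<phi> (contract v (full_cobd \<phi>))"
      using ell2_inner_restr[OF assms(2)] by (simp add: ell2_inner_commute)
    ultimately show ?thesis by (simp add: ell2_inner_linear ell2_inner_commute[of _ \<phi> ?g])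
  qed
  then have "(\<Sum>v\<in>V. norm2 (restr X (full_cobd (contract v \<phi>)))) =
      real (card V) * norm2 \<phi> - 2 * (\<Sum>v\<in>V. inner_V \<phi> (contract v (full_cobd \<phi>)))
      + (\<Sum>v\<in>V. norm2 (restr X (contract v (full_cobd \<phi>))))"
    by (simp add: sum.distrib sum_subtractf sum_distrib_left)
  also have "(\<Sum>v\<in>V. inner_V \<phi> (contract v (full_cobd \<phi>))) = norm2 (full_cobd \<phi>)"
    unfolding full_cobd_adjoint[of \<phi>] full_bd_eq_sum_contract[of "full_cobd \<phi>"]
    by (simp add: ell2_inner_sum_right)
  also have "(\<Sum>v\<in>V. norm2 (restr X (contract v (full_cobd \<phi>)))) =
      (\<Sum>\<sigma>\<in>Pow V. real (facets_in X \<sigma>) * (full_cobd \<phi> \<sigma>)\<^sup>2)"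
    by (rule sum_norm2_restr_contract)
  finally show ?thesis
    unfolding norm2_sum[of "full_cobd \<phi>"]
    by (simp add: left_diff_distrib sum_subtractf sum_distrib_left)
qed

end

section \<open>Laplacians of a subcomplex\<close>

lemma linear_op_comp:
  "linear_op X Y F \<Longrightarrow> linear_op Y Z G \<Longrightarrow> linear_op X Z (\<lambda>\<phi>. G (F \<phi>))"
  unfolding linear_op_def by (simp add: ell2_def)

lemma linear_op_plus:
  assumes "linear_op X Y F" "linear_op X Y G"
  shows "linear_op X Y (\<lambda>\<phi> \<tau>. F \<phi> \<tau> + G \<phi> \<tau>)"
  using assms unfolding linear_op_def by (simp add: ell2_def algebra_simps)

locale signed_complex = signed_simplex V s for V :: "'a set" and s +
  fixes S :: "'a set set"
  assumes simplicial_complex: "simplicial_complex_on V S"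
begin

lemma S_subset: "S \<subseteq> Pow V"
  using simplicial_complex by (simp add: simplicial_complex_on_def)

lemma S_down: "\<sigma> \<in> S \<Longrightarrow> \<tau> \<subseteq> \<sigma> \<Longrightarrow> \<tau> \<in> S"
  using simplicial_complex by (simp add: simplicial_complex_on_def)

lemma faces_subset: "faces S k \<subseteq> Pow V"
  using S_subset by (auto simp: faces_def)

lemma finite_faces: "finite (faces S k)"
  using faces_subset finite_V finite_subset by blast

lemma finite_simplex: "\<sigma> \<subseteq> V \<Longrightarrow> finite \<sigma>"
  using finite_V finite_subset by blast

lemma inner_faces:
  fixes \<phi> :: "'a set \<Rightarrow> real"
  shows "\<phi> \<in> ell2 (faces S k) \<Longrightarrow> ell2_inner (faces S k) \<phi> \<psi> = inner_V \<phi> \<psi>"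
  using ell2_inner_superset faces_subset finite_V by blast

lemma face_insertD:
  assumes "insert v \<tau> \<in> faces S (k + 1)" "v \<notin> \<tau>"
  shows "\<tau> \<in> faces S k"
proof -
  have "finite (insert v \<tau>)" using assms(1) faces_subset finite_simplex by blast
  then show ?thesis using assms S_down by (auto simp: faces_def)
qed

definition cob :: "int \<Rightarrow> ('a set \<Rightarrow> 'f::conjugatable_field) \<Rightarrow> 'a set \<Rightarrow> 'f" where
  "cob k \<phi> = restr (faces S (k + 1)) (full_cobd \<phi>)"

lemma cob_linear:
  "linear_op (faces S k) (faces S (k + 1)) (cob k)"
  unfolding linear_op_def cob_def
proof (intro conjI ballI allI)
  show "restr (faces S (k + 1)) (full_cobd \<phi>) \<in> ell2 (faces S (k + 1))" for \<phi> :: "'a set \<Rightarrow> 'f::conjugatable_field"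
    by (rule restr_in_ell2)
qed (auto simp: fun_eq_iff restr_def full_cobd_def sum.distrib sum_distrib_left algebra_simps)

text \<open>Closure of \<open>S\<close> under subsets keeps boundaries inside \<open>S\<close>.
  Hence the adjoint of the truncated coboundary \<open>cob\<close> is \<open>full_bd\<close> itself,
  without truncation.\<close>

lemma full_bd_closed:
  fixes \<phi> :: "'a set \<Rightarrow> 'f::conjugatable_field"
  assumes "\<phi> \<in> ell2 (faces S (k + 1))"
  shows "full_bd \<phi> \<in> ell2 (faces S k)"
proof (rule ell2_I)
  fix \<tau> assume "\<tau> \<notin> faces S k"
  then have "\<phi> (insert v \<tau>) = 0" if "v \<notin> \<tau>" for v
    using face_insertD[of v \<tau> k] that ell2_D[OF assms, of "insert v \<tau>"] by blast
  then show "full_bd \<phi> \<tau> = 0" by (simp add: full_bd_def)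
qed

lemma contract_closed:
  fixes \<phi> :: "'a set \<Rightarrow> 'f::conjugatable_field"
  assumes "\<phi> \<in> ell2 (faces S (k + 1))"
  shows "contract v \<phi> \<in> ell2 (faces S k)"
proof (rule ell2_I)
  fix \<tau> assume "\<tau> \<notin> faces S k"
  then have "\<phi> (insert v \<tau>) = 0" if "v \<notin> \<tau>" for v
    using face_insertD[of v \<tau> k] that ell2_D[OF assms, of "insert v \<tau>"] by blast
  then show "contract v \<phi> \<tau> = 0" by (simp add: contract_def)
qed

lemma full_bd_linear: "linear_op (faces S (k + 1)) (faces S k) full_bd"
  unfolding linear_op_def
  by (auto simp: full_bd_closed fun_eq_iff full_bd_def sum.distrib sum_distrib_left algebra_simps)

definition lap_up :: "int \<Rightarrow> ('a set \<Rightarrow> 'f::conjugatable_field) \<Rightarrow> 'a set \<Rightarrow> 'f" where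
  "lap_up k \<phi> = full_bd (cob k \<phi>)"

definition lap_down :: "int \<Rightarrow> ('a set \<Rightarrow> 'f::conjugatable_field) \<Rightarrow> 'a set \<Rightarrow> 'f" where
  "lap_down k \<phi> = cob (k - 1) (full_bd \<phi>)"

primrec lap :: "laplacian_kind \<Rightarrow> int \<Rightarrow> ('a set \<Rightarrow> 'f::conjugatable_field) \<Rightarrow> 'a set \<Rightarrow> 'f" where
  "lap Up = lap_up"
| "lap Down = lap_down"
| "lap Hodge = (\<lambda>k \<phi> \<tau>. lap_up k \<phi> \<tau> + lap_down k \<phi> \<tau>)"

lemma lap_up_linear: "linear_op (faces S k) (faces S k) (lap_up k)"
  unfolding lap_up_def by (rule linear_op_comp[OF cob_linear full_bd_linear])

lemma lap_down_linear: "linear_op (faces S k) (faces S k) (lap_down k)"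
  unfolding lap_down_def
  using linear_op_comp[OF full_bd_linear[of "k - 1"] cob_linear[of "k - 1"]] by simp

lemma lap_linear: "linear_op (faces S k) (faces S k) (lap c k)"
  by (cases c) (simp_all add: lap_up_linear lap_down_linear linear_op_plus)

section \<open>Quadratic forms and extremal eigenvalues of the Laplacians\<close>

lemma cob_adjoint:
  "\<psi> \<in> ell2 (faces S (k + 1)) \<Longrightarrow> inner_V (cob k \<phi>) \<psi> = inner_V \<phi> (full_bd \<psi>)"
  unfolding cob_def by (simp add: ell2_inner_restr full_cobd_adjoint)

lemma cob_closed: "cob k \<phi> \<in> ell2 (faces S (k + 1))"
  by (simp add: cob_def restr_in_ell2)

lemma inner_lap_up: "inner_V (lap_up k \<phi>) \<psi> = inner_V (cob k \<phi>) (cob k \<psi>)"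
  unfolding lap_up_def using cob_adjoint[OF cob_closed, of k \<psi> \<phi>]
  by (simp add: ell2_inner_commute)

lemma inner_lap_down:
  "\<psi> \<in> ell2 (faces S k) \<Longrightarrow> inner_V (lap_down k \<phi>) \<psi> = inner_V (full_bd \<phi>) (full_bd \<psi>)"
  unfolding lap_down_def using cob_adjoint[of \<psi> "k - 1"] by simp

lemma inner_lap:
  assumes "\<psi> \<in> ell2 (faces S k)"
  shows "inner_V (lap c k \<phi>) \<psi> =
    (if c = Down then 0 else inner_V (cob k \<phi>) (cob k \<psi>)) +
    (if c = Up then 0 else inner_V (full_bd \<phi>) (full_bd \<psi>))"
  using assms by (cases c) (simp_all add: inner_lap_up inner_lap_down ell2_inner_add_left)

lemma lap_symmetric:
  fixes \<phi> \<psi> :: "'a set \<Rightarrow> real"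
  assumes "\<phi> \<in> ell2 (faces S k)" "\<psi> \<in> ell2 (faces S k)"
  shows "ell2_inner (faces S k) (lap c k \<phi>) \<psi> = ell2_inner (faces S k) \<phi> (lap c k \<psi>)"
proof -
  have "inner_V (lap c k \<phi>) \<psi> = inner_V (lap c k \<psi>) \<phi>"
    unfolding inner_lap[OF assms(1)] inner_lap[OF assms(2)] by (simp add: ell2_inner_commute)
  then show ?thesis
    using assms linear_op_closed[OF lap_linear assms(1)]
    by (simp add: inner_faces ell2_inner_commute[of "Pow V" \<phi>])
qed

text \<open>Taken over the real scalars throughout; complex spectra are reduced to these at the
  end.\<close>

definition lam :: "laplacian_kind \<Rightarrow> int \<Rightarrow> real" where
  "lam c k = Max (spectrum_op (faces S k) (lap c k))"

definition mu :: "int \<Rightarrow> real" where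
  "mu k = Min (spectrum_op (faces S k) (lap Hodge k))"

lemma lam_bound:
  assumes "faces S k \<noteq> {}" "\<psi> \<in> ell2 (faces S k)"
  shows "inner_V (lap c k \<psi>) \<psi> \<le> lam c k * norm2 \<psi>"
  using Max_spectrum_symmetric(2)[OF finite_faces assms(1) lap_linear lap_symmetric assms(2), of c]
    linear_op_closed[OF lap_linear assms(2)] assms(2)
  by (simp add: lam_def inner_faces)

lemma lam_eigenfunction:
  assumes "faces S k \<noteq> {}"
  obtains \<phi> where "\<phi> \<in> ell2 (faces S k)" "norm2 \<phi> > 0" "lap c k \<phi> = (\<lambda>\<tau>. lam c k * \<phi> \<tau>)"
proof -
  obtain \<phi> where e: "eigenfunction (faces S k) (lap c k) (lam c k) \<phi>"
    using Max_spectrum_symmetric(1)[OF finite_faces assms lap_linear lap_symmetric, of c]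
    unfolding lam_def by blast
  then show ?thesis
    using that[of \<phi>] eigenfunction_pos[OF finite_faces e]
    by (simp add: eigenfunction_def inner_faces del: lap.simps)
qed

lemma mu_bound:
  assumes "faces S k \<noteq> {}" "\<psi> \<in> ell2 (faces S k)"
  shows "mu k * norm2 \<psi> \<le> inner_V (lap Hodge k \<psi>) \<psi>"
  using Min_spectrum_symmetric(2)[OF finite_faces assms(1) lap_linear lap_symmetric assms(2), of Hodge]
    linear_op_closed[OF lap_linear assms(2), of Hodge] assms(2)
  by (simp add: mu_def inner_faces del: lap.simps)

lemma mu_eigenfunction:
  assumes "faces S k \<noteq> {}"
  obtains \<phi> where "\<phi> \<in> ell2 (faces S k)" "norm2 \<phi> > 0" "lap Hodge k \<phi> = (\<lambda>\<tau>. mu k * \<phi> \<tau>)"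
proof -
  obtain \<phi> where e: "eigenfunction (faces S k) (lap Hodge k) (mu k) \<phi>"
    using Min_spectrum_symmetric(1)[OF finite_faces assms lap_linear lap_symmetric, of Hodge]
    unfolding mu_def by blast
  then show ?thesis
    using that[of \<phi>] eigenfunction_pos[OF finite_faces e]
    by (simp add: eigenfunction_def inner_faces del: lap.simps)
qed

lemma norm2_cob_le: "norm2 (cob k \<phi>) \<le> norm2 (full_cobd \<phi>)"
  unfolding norm2_sum by (intro sum_mono) (simp add: cob_def restr_def)

lemma norm2_cob_le_card: "norm2 (cob k \<phi>) \<le> real (card V) * norm2 \<phi>"
  using norm2_cob_le[of k \<phi>] norm2_full_cobd_full_bd[of \<phi>] norm2_nonneg[of "full_bd \<phi>"] by linarith

lemma norm2_eq_0: "\<phi> \<in> ell2 (faces S k) \<Longrightarrow> norm2 \<phi> = 0 \<Longrightarrow> \<phi> = (\<lambda>_. 0)"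
  using ell2_inner_self_pos[OF finite_faces, of \<phi>] inner_faces[of \<phi> k \<phi>] by (metis less_irrefl)

text \<open>Dual to \<open>full_bd_full_bd\<close>: moving both coboundaries to the other side of
  the inner product leaves a double boundary.\<close>

lemma cob_cob:
  fixes \<phi> :: "'a set \<Rightarrow> real"
  shows "cob (k + 1) (cob k \<phi>) = (\<lambda>_. 0)"
proof (rule norm2_eq_0[OF cob_closed])
  have "norm2 (cob (k + 1) (cob k \<phi>)) = inner_V (cob k \<phi>) (full_bd (cob (k + 1) (cob k \<phi>)))"
    by (rule cob_adjoint[OF cob_closed])
  also have "\<dots> = inner_V \<phi> (full_bd (full_bd (cob (k + 1) (cob k \<phi>))))"
    by (rule cob_adjoint[OF full_bd_closed[OF cob_closed]])
  also have "\<dots> = 0" by (simp add: full_bd_full_bd ell2_inner_real)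
  finally show "norm2 (cob (k + 1) (cob k \<phi>)) = 0" .
qed

section \<open>Contraction sums for functions on the faces of one dimension\<close>

lemma sum_norm2_contract_face:
  assumes "\<phi> \<in> ell2 (faces S k)"
  shows "(\<Sum>v\<in>V. norm2 (contract v \<phi>)) = of_int (k + 1) * norm2 \<phi>"
proof -
  have "real (card \<sigma>) * (\<phi> \<sigma>)\<^sup>2 = of_int (k + 1) * (\<phi> \<sigma>)\<^sup>2" for \<sigma>
  proof (cases "\<sigma> \<in> faces S k")
    case True
    then have "int (card \<sigma>) = k + 1" by (simp add: faces_def)
    then have "real_of_int (int (card \<sigma>)) = of_int (k + 1)" by (rule arg_cong)
    then show ?thesis by simp
  next
    case False
    then show ?thesis using ell2_D[OF assms] by simp
  qed
  then show ?thesis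
    unfolding sum_norm2_contract norm2_sum[of \<phi>] sum_distrib_left by (intro sum.cong refl)
qed

text \<open>Boundary and contraction anticommute, and \<open>full_bd \<phi>\<close> lives on
  simplices with k vertices; hence the factor k in place of k + 1.\<close>

lemma sum_norm2_bd_contract:
  assumes "\<phi> \<in> ell2 (faces S k)"
  shows "(\<Sum>v\<in>V. norm2 (full_bd (contract v \<phi>))) = of_int k * norm2 (full_bd \<phi>)"
proof -
  have "norm2 (full_bd (contract v \<phi>)) = norm2 (contract v (full_bd \<phi>))" if "v \<in> V" for v
    unfolding norm2_sum by (simp add: full_bd_contract[OF that])
  moreover have "full_bd \<phi> \<in> ell2 (faces S (k - 1))"
    using assms full_bd_closed[of \<phi> "k - 1"] by simp
  ultimately show ?thesis using sum_norm2_contract_face[of "full_bd \<phi>" "k - 1"] by simp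
qed

lemma facets_in_faces_le: "\<sigma> \<subseteq> V \<Longrightarrow> facets_in X \<sigma> \<le> card \<sigma>"
  unfolding facets_in_def using finite_simplex by (intro card_mono) auto

lemma facets_in_face:
  assumes "\<sigma> \<in> faces S (k + 1)"
  shows "int (facets_in (faces S k) \<sigma>) = k + 2"
proof -
  have "\<sigma> - {w} \<in> faces S k" if "w \<in> \<sigma>" for w
    by (rule face_insertD[of w]) (use assms that in \<open>auto simp: insert_absorb\<close>)
  then have "{w \<in> \<sigma>. \<sigma> - {w} \<in> faces S k} = \<sigma>" by blast
  then show ?thesis using assms by (simp add: facets_in_def faces_def)
qed

lemma norm2_full_cobd_split:
  "norm2 (full_cobd \<phi>) = norm2 (cob k \<phi>) +
    (\<Sum>\<sigma>\<in>Pow V. if \<sigma> \<in> faces S (k + 1) then 0 else (full_cobd \<phi> \<sigma>)\<^sup>2)"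
  unfolding norm2_sum sum.distrib[symmetric] by (intro sum.cong) (auto simp: cob_def restr_def)

lemma sum_cobd_contract_split:
  assumes "\<phi> \<in> ell2 (faces S k)"
  shows "(\<Sum>v\<in>V. norm2 (cob (k - 1) (contract v \<phi>))) =
    real (card V) * norm2 \<phi> + of_int k * norm2 (cob k \<phi>)
    + (\<Sum>\<sigma>\<in>Pow V. if \<sigma> \<in> faces S (k + 1) then 0
        else (real (facets_in (faces S k) \<sigma>) - 2) * (full_cobd \<phi> \<sigma>)\<^sup>2)"
proof -
  have "(\<Sum>\<sigma>\<in>Pow V. (real (facets_in (faces S k) \<sigma>) - 2) * (full_cobd \<phi> \<sigma>)\<^sup>2) =
    (\<Sum>\<sigma>\<in>Pow V. of_int k * (cob k \<phi> \<sigma>)\<^sup>2 + (if \<sigma> \<in> faces S (k + 1) then 0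
        else (real (facets_in (faces S k) \<sigma>) - 2) * (full_cobd \<phi> \<sigma>)\<^sup>2))"
  proof (intro sum.cong refl)
    fix \<sigma>
    show "(real (facets_in (faces S k) \<sigma>) - 2) * (full_cobd \<phi> \<sigma>)\<^sup>2 =
      of_int k * (cob k \<phi> \<sigma>)\<^sup>2 + (if \<sigma> \<in> faces S (k + 1) then 0
        else (real (facets_in (faces S k) \<sigma>) - 2) * (full_cobd \<phi> \<sigma>)\<^sup>2)"
    proof (cases "\<sigma> \<in> faces S (k + 1)")
      case True
      have "real (facets_in (faces S k) \<sigma>) = of_int (int (facets_in (faces S k) \<sigma>))" by simp
      then have "real (facets_in (faces S k) \<sigma>) = of_int k + 2"
        unfolding facets_in_face[OF True] by simp
      then show ?thesis using True by (simp add: cob_def restr_def)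
    qed (simp add: cob_def restr_def)
  qed
  then show ?thesis
    using sum_norm2_cobd_contract[OF faces_subset assms]
    by (simp add: cob_def norm2_sum sum.distrib sum_distrib_left)
qed

text \<open>Faces of \<open>S\<close> have facet count k + 2 and contribute with weight k. The rest
  of the squared coboundary, \<open>?R\<close>, is known from the identity on the full simplex and
  gets weight at least a - 1; collecting terms gives the coefficients a, k + 1 - a and 1 - a. The
  count is required only where the coboundary is nonzero, which later permits a value
  \<open>a\<close> coming from another dimension.\<close>

lemma sum_cobd_contract_ge:
  assumes \<phi>: "\<phi> \<in> ell2 (faces S k)"
    and a: "\<And>\<sigma>. \<sigma> \<subseteq> V \<Longrightarrow> \<sigma> \<notin> faces S (k + 1) \<Longrightarrow> full_cobd \<phi> \<sigma> \<noteq> 0 \<Longrightarrow>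
      a + 1 \<le> int (facets_in (faces S k) \<sigma>)"
  shows "a * real (card V) * norm2 \<phi> + of_int (k + 1 - a) * norm2 (cob k \<phi>)
      + (1 - a) * norm2 (full_bd \<phi>)
    \<le> (\<Sum>v\<in>V. norm2 (cob (k - 1) (contract v \<phi>)))"
proof -
  let ?R = "\<Sum>\<sigma>\<in>Pow V. if \<sigma> \<in> faces S (k + 1) then 0 else (full_cobd \<phi> \<sigma>)\<^sup>2"
  have R: "?R = real (card V) * norm2 \<phi> - norm2 (full_bd \<phi>) - norm2 (cob k \<phi>)"
    using norm2_full_cobd_split[of \<phi> k] norm2_full_cobd_full_bd[of \<phi>] by linarith
  have "(of_int a - 1) * ?R \<le> (\<Sum>\<sigma>\<in>Pow V. if \<sigma> \<in> faces S (k + 1) then 0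
        else (real (facets_in (faces S k) \<sigma>) - 2) * (full_cobd \<phi> \<sigma>)\<^sup>2)"
    unfolding sum_distrib_left
  proof (rule sum_mono)
    fix \<sigma> assume \<sigma>: "\<sigma> \<in> Pow V"
    have "real_of_int a - 1 \<le> real (facets_in (faces S k) \<sigma>) - 2"
      if "\<sigma> \<notin> faces S (k + 1)" "full_cobd \<phi> \<sigma> \<noteq> 0"
      using a[OF _ that] \<sigma> by auto
    then show "(of_int a - 1) * (if \<sigma> \<in> faces S (k + 1) then 0 else (full_cobd \<phi> \<sigma>)\<^sup>2) \<le>
      (if \<sigma> \<in> faces S (k + 1) then 0
        else (real (facets_in (faces S k) \<sigma>) - 2) * (full_cobd \<phi> \<sigma>)\<^sup>2)"
      by (cases "full_cobd \<phi> \<sigma> = 0") (auto intro: mult_right_mono)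
  qed
  then show ?thesis
    unfolding R sum_cobd_contract_split[OF \<phi>] by (simp add: algebra_simps)
qed

lemma sum_cobd_contract_le:
  assumes \<phi>: "\<phi> \<in> ell2 (faces S k)"
    and b: "\<And>\<sigma>. \<sigma> \<subseteq> V \<Longrightarrow> \<sigma> \<notin> faces S (k + 1) \<Longrightarrow> full_cobd \<phi> \<sigma> \<noteq> 0 \<Longrightarrow>
      int (facets_in (faces S k) \<sigma>) \<le> b + 1"
  shows "(\<Sum>v\<in>V. norm2 (cob (k - 1) (contract v \<phi>)))
    \<le> b * real (card V) * norm2 \<phi> + of_int (k + 1 - b) * norm2 (cob k \<phi>)
      + (1 - b) * norm2 (full_bd \<phi>)"
proof -
  let ?R = "\<Sum>\<sigma>\<in>Pow V. if \<sigma> \<in> faces S (k + 1) then 0 else (full_cobd \<phi> \<sigma>)\<^sup>2"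
  have R: "?R = real (card V) * norm2 \<phi> - norm2 (full_bd \<phi>) - norm2 (cob k \<phi>)"
    using norm2_full_cobd_split[of \<phi> k] norm2_full_cobd_full_bd[of \<phi>] by linarith
  have "(\<Sum>\<sigma>\<in>Pow V. if \<sigma> \<in> faces S (k + 1) then 0
        else (real (facets_in (faces S k) \<sigma>) - 2) * (full_cobd \<phi> \<sigma>)\<^sup>2) \<le> (of_int b - 1) * ?R"
    unfolding sum_distrib_left
  proof (rule sum_mono)
    fix \<sigma> assume \<sigma>: "\<sigma> \<in> Pow V"
    have "real (facets_in (faces S k) \<sigma>) - 2 \<le> real_of_int b - 1"
      if "\<sigma> \<notin> faces S (k + 1)" "full_cobd \<phi> \<sigma> \<noteq> 0"
      using b[OF _ that] \<sigma> by auto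
    then show "(if \<sigma> \<in> faces S (k + 1) then 0
        else (real (facets_in (faces S k) \<sigma>) - 2) * (full_cobd \<phi> \<sigma>)\<^sup>2) \<le>
      (of_int b - 1) * (if \<sigma> \<in> faces S (k + 1) then 0 else (full_cobd \<phi> \<sigma>)\<^sup>2)"
      by (cases "full_cobd \<phi> \<sigma> = 0") (auto intro: mult_right_mono)
  qed
  then show ?thesis
    unfolding R sum_cobd_contract_split[OF \<phi>] by (simp add: algebra_simps)
qed

end

section \<open>Comparison of extremal eigenvalues\<close>

context signed_complex
begin

section \<open>Facet counts of non-faces in terms of alpha and beta\<close>

lemma missing_card:
  assumes "\<sigma> \<in> missing V S k"
  shows "\<sigma> \<subseteq> V" "int (card \<sigma>) = k + 2"
  using assms by (auto simp: missing_def faces_def)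

lemma missingI:
  assumes "\<sigma> \<subseteq> V" "\<sigma> \<notin> faces S (k + 1)" "w \<in> \<sigma>" "\<sigma> - {w} \<in> faces S k"
  shows "\<sigma> \<in> missing V S k"
proof -
  have "card \<sigma> = Suc (card (\<sigma> - {w}))"
    using card_Suc_Diff1[OF finite_simplex[OF assms(1)] assms(3)] by simp
  then have "int (card \<sigma>) = k + 2" using assms(4) by (simp add: faces_def)
  then show ?thesis using assms by (auto simp: missing_def faces_def)
qed

text \<open>A k-face inside \<sigma> omits exactly one of its k + 2 vertices. Counting by the
  omitted vertex therefore agrees with the count of faces in \<open>alpha\<close> and
  \<open>beta\<close>.\<close>

lemma card_subfaces:
  assumes \<sigma>: "\<sigma> \<subseteq> V" and c: "int (card \<sigma>) = k + 2"
  shows "card {\<tau> \<in> faces S k. \<tau> \<subseteq> \<sigma>} = facets_in (faces S k) \<sigma>"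
  unfolding facets_in_def
proof (rule bij_betw_same_card[symmetric])
  show "bij_betw (\<lambda>w. \<sigma> - {w}) {w \<in> \<sigma>. \<sigma> - {w} \<in> faces S k} {\<tau> \<in> faces S k. \<tau> \<subseteq> \<sigma>}"
    unfolding bij_betw_def
  proof (intro conjI equalityI subsetI)
    show "inj_on (\<lambda>w. \<sigma> - {w}) {w \<in> \<sigma>. \<sigma> - {w} \<in> faces S k}"
      by (rule inj_onI) blast
    fix \<tau> assume \<tau>: "\<tau> \<in> {\<tau> \<in> faces S k. \<tau> \<subseteq> \<sigma>}"
    then have "card (\<sigma> - \<tau>) = 1"
      using c finite_simplex[OF \<sigma>] by (auto simp: faces_def card_Diff_subset finite_subset)
    then obtain w where "\<sigma> - \<tau> = {w}" by (rule card_1_singletonE)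
    then have "w \<in> \<sigma>" "\<tau> = \<sigma> - {w}" using \<tau> by auto
    then show "\<tau> \<in> (\<lambda>w. \<sigma> - {w}) ` {w \<in> \<sigma>. \<sigma> - {w} \<in> faces S k}" using \<tau> by blast
  qed auto
qed

lemma finite_missing: "finite (missing V S k)"
  by (rule finite_subset[of _ "Pow V"]) (auto simp: finite_V dest: missing_card)

lemma alpha_le_facets:
  assumes "\<sigma> \<in> missing V S k"
  shows "alpha V S k + 1 \<le> int (facets_in (faces S k) \<sigma>)"
proof -
  have "(MIN \<sigma>\<in>missing V S k. int (card {\<tau> \<in> faces S k. \<tau> \<subseteq> \<sigma>})) \<le> int (card {\<tau> \<in> faces S k. \<tau> \<subseteq> \<sigma>})"
    using assms finite_missing by (intro Min_le) auto
  then show ?thesis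
    using assms card_subfaces[OF missing_card[OF assms]] by (auto simp: alpha_def)
qed

lemma facets_le_beta:
  assumes "\<sigma> \<in> missing V S k"
  shows "int (facets_in (faces S k) \<sigma>) \<le> beta V S k + 1"
proof -
  have "int (card {\<tau> \<in> faces S k. \<tau> \<subseteq> \<sigma>}) \<le> (MAX \<sigma>\<in>missing V S k. int (card {\<tau> \<in> faces S k. \<tau> \<subseteq> \<sigma>}))"
    using assms finite_missing by (intro Max_ge) auto
  then show ?thesis
    using assms card_subfaces[OF missing_card[OF assms]] by (auto simp: beta_def)
qed

lemma alpha_bounds:
  assumes "k \<ge> -1"
  shows "0 \<le> alpha V S k" "alpha V S k \<le> k + 1"
proof -
  have "0 \<le> alpha V S k \<and> alpha V S k \<le> k + 1"
  proof (cases "missing V S k = {}")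
    case True
    then show ?thesis using assms by (simp add: alpha_def)
  next
    case False
    let ?f = "\<lambda>\<sigma>. int (card {\<tau> \<in> faces S k. \<tau> \<subseteq> \<sigma>})"
    have "Min (?f ` missing V S k) \<in> ?f ` missing V S k"
      using False finite_missing by (intro Min_in) auto
    then obtain \<sigma> where \<sigma>: "\<sigma> \<in> missing V S k" "Min (?f ` missing V S k) = ?f \<sigma>" by blast
    have "?f \<sigma> \<le> k + 2"
      using facets_in_faces_le[OF missing_card(1)[OF \<sigma>(1)], of "faces S k"]
        missing_card(2)[OF \<sigma>(1)] card_subfaces[OF missing_card[OF \<sigma>(1)]] by simp
    moreover have "{\<tau> \<in> faces S k. \<tau> \<subseteq> \<sigma>} \<noteq> {}" using \<sigma>(1) by (auto simp: missing_def)
    then have "?f \<sigma> \<ge> 1"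
      using finite_faces[of k] by (simp add: Suc_le_eq card_gt_0_iff)
    ultimately show ?thesis using \<sigma>(2) False by (simp add: alpha_def)
  qed
  then show "0 \<le> alpha V S k" "alpha V S k \<le> k + 1" by auto
qed

lemma full_cobd_nonzeroD:
  fixes \<phi> :: "'a set \<Rightarrow> 'f::comm_ring_1"
  assumes "full_cobd \<phi> \<sigma> \<noteq> 0"
  obtains w where "w \<in> \<sigma>" "\<phi> (\<sigma> - {w}) \<noteq> 0"
  using assms unfolding full_cobd_def by (metis (no_types, lifting) mult_zero_right sum.neutral)

lemma full_bd_nonzeroD:
  fixes \<phi> :: "'a set \<Rightarrow> 'f::comm_ring_1"
  assumes "full_bd \<phi> \<tau> \<noteq> 0"
  obtains w where "w \<notin> \<tau>" "\<phi> (insert w \<tau>) \<noteq> 0"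
  using assms unfolding full_bd_def by (metis (no_types, lifting) DiffD2 mult_zero_right sum.neutral)

text \<open>A nonzero value of the coboundary at \<sigma> needs a facet in the support of \<phi>,
  hence in \<open>S\<close>. So the bounds by \<open>alpha\<close> and \<open>beta\<close> apply
  wherever they are required; without missing simplices the requirement is vacuous and the default
  value 0 satisfies it.\<close>

lemma cobd_support_missing:
  fixes \<phi> :: "'a set \<Rightarrow> 'f::conjugatable_field"
  assumes "\<phi> \<in> ell2 (faces S k)" "\<sigma> \<subseteq> V" "\<sigma> \<notin> faces S (k + 1)" "full_cobd \<phi> \<sigma> \<noteq> 0"
  shows "\<sigma> \<in> missing V S k"
  using assms missingI ell2_D by (metis full_cobd_nonzeroD)

text \<open>If a facet of a non-face \<open>\<sigma>\<close> lies in a \<open>k\<close>-face \<open>\<tau>\<close>, then the facets of \<open>\<sigma> \<union> \<tau>\<close>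
  belonging to \<open>S\<close> are cut out on \<open>\<sigma>\<close> by facets of \<open>\<sigma>\<close> belonging to \<open>S\<close>.\<close>

lemma alpha_le_facets_pred:
  assumes \<sigma>: "\<sigma> \<subseteq> V" "\<sigma> \<notin> faces S k" and w: "w \<in> \<sigma>"
    and x: "x \<notin> \<sigma> - {w}" "insert x (\<sigma> - {w}) \<in> faces S k"
  shows "alpha V S k + 1 \<le> int (facets_in (faces S (k - 1)) \<sigma>)"
proof -
  have fin: "finite \<sigma>" using finite_simplex[OF \<sigma>(1)] .
  \<comment> \<open>The remaining possibility x = w would make
    \<open>insert x (\<sigma> - {w})\<close> equal to \<sigma>, which is not a face.\<close>
  have "x \<notin> \<sigma>" using x w \<sigma>(2) by (auto simp: insert_absorb)
  have "\<sigma> - {w} \<in> faces S (k - 1)" using face_insertD[of x _ "k - 1"] x by simp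
  then have c: "int (card \<sigma>) = k + 1"
    using card_Suc_Diff1[OF fin w] by (simp add: faces_def)
  then have nS: "\<sigma> \<notin> S" using \<sigma>(2) by (simp add: faces_def)
  let ?\<rho> = "insert x \<sigma>"
  have xV: "x \<in> V" using x(2) faces_subset by blast
  have i: "?\<rho> - {w} = insert x (\<sigma> - {w})" using w \<open>x \<notin> \<sigma>\<close> by auto
  have "?\<rho> \<notin> S" using nS S_down by blast
  then have "?\<rho> \<in> missing V S k"
    using \<sigma>(1) xV w x(2) by (intro missingI[of _ _ w]) (simp_all add: i faces_def)
  then have "alpha V S k + 1 \<le> int (facets_in (faces S k) ?\<rho>)" by (rule alpha_le_facets)
  also have "\<dots> \<le> int (facets_in (faces S (k - 1)) \<sigma>)"
    unfolding facets_in_def of_nat_le_iff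
  proof (rule card_mono)
    show "finite {u \<in> \<sigma>. \<sigma> - {u} \<in> faces S (k - 1)}" using fin by simp
    show "{u \<in> ?\<rho>. ?\<rho> - {u} \<in> faces S k} \<subseteq> {u \<in> \<sigma>. \<sigma> - {u} \<in> faces S (k - 1)}"
    proof
      fix u assume u: "u \<in> {u \<in> ?\<rho>. ?\<rho> - {u} \<in> faces S k}"
      \<comment> \<open>Removing \<open>x\<close> from \<open>?\<rho>\<close> would leave \<sigma>,
        which is not in \<open>S\<close>.\<close>
      then have "u \<noteq> x" using nS \<open>x \<notin> \<sigma>\<close> by (auto simp: faces_def)
      then have "u \<in> \<sigma>" using u by simp
      then have "int (card (\<sigma> - {u})) = k" using card_Suc_Diff1[OF fin, of u] c by linarith
      moreover have "\<sigma> - {u} \<in> S" using u S_down[of "?\<rho> - {u}" "\<sigma> - {u}"] by (auto simp: faces_def)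
      ultimately show "u \<in> {u \<in> \<sigma>. \<sigma> - {u} \<in> faces S (k - 1)}"
        using \<open>u \<in> \<sigma>\<close> unfolding faces_def by simp
    qed
  qed
  finally show ?thesis .
qed

lemma faces_pred_nonempty:
  assumes "k \<ge> 0" "faces S k \<noteq> {}"
  shows "faces S (k - 1) \<noteq> {}"
proof -
  obtain \<tau> where \<tau>: "\<tau> \<in> faces S k" using assms by blast
  then have "\<tau> \<noteq> {}" using assms by (auto simp: faces_def)
  then obtain v where "v \<in> \<tau>" by blast
  then show ?thesis
    using face_insertD[of v "\<tau> - {v}" "k - 1"] \<tau> by (auto simp: insert_absorb)
qed

section \<open>The Hodge Laplacian\<close>

lemma lam_nonneg:
  assumes "faces S k \<noteq> {}"
  shows "0 \<le> lam c k"
proof -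
  obtain \<phi> where \<phi>: "\<phi> \<in> ell2 (faces S k)" "norm2 \<phi> > 0" "lap c k \<phi> = (\<lambda>\<tau>. lam c k * \<phi> \<tau>)"
    by (rule lam_eigenfunction[OF assms])
  have "inner_V (lap c k \<phi>) \<phi> \<ge> 0"
    unfolding inner_lap[OF \<phi>(1)] by (simp add: norm2_nonneg)
  then show ?thesis using \<phi>(2) by (simp add: \<phi>(3) ell2_inner_linear zero_le_mult_iff)
qed

lemma hodge_identity:
  assumes "\<phi> \<in> ell2 (faces S k)"
  shows "(\<Sum>v\<in>V. inner_V (lap Hodge (k - 1) (contract v \<phi>)) (contract v \<phi>)) =
    (\<Sum>v\<in>V. norm2 (cob (k - 1) (contract v \<phi>))) + of_int k * norm2 (full_bd \<phi>)"
proof -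
  have "contract v \<phi> \<in> ell2 (faces S (k - 1))" for v
    using contract_closed[of \<phi> "k - 1"] assms by simp
  then show ?thesis
    using sum_norm2_bd_contract[OF assms] by (simp add: inner_lap sum.distrib del: lap.simps)
qed

lemma lam_Hodge_le:
  assumes "1 \<le> k" "faces S k \<noteq> {}"
  shows "of_int (k + 1 - alpha V S k) * lam Hodge k + of_int (alpha V S k) * real (card V)
    \<le> of_int (k + 1) * lam Hodge (k - 1)"
proof -
  let ?a = "alpha V S k"
  obtain \<phi> where \<phi>: "\<phi> \<in> ell2 (faces S k)" "norm2 \<phi> > 0"
      "lap Hodge k \<phi> = (\<lambda>\<tau>. lam Hodge k * \<phi> \<tau>)"
    by (rule lam_eigenfunction[OF assms(2)])
  have q: "norm2 (cob k \<phi>) + norm2 (full_bd \<phi>) = lam Hodge k * norm2 \<phi>"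
    using inner_lap[OF \<phi>(1), of Hodge \<phi>] unfolding \<phi>(3) ell2_inner_linear by simp
  have c: "contract v \<phi> \<in> ell2 (faces S (k - 1))" for v
    using contract_closed[of \<phi> "k - 1"] \<phi>(1) by simp
  \<comment> \<open>The coefficients (1 - a) + k of the boundary term and k + 1 - a of the
    coboundary term agree, so the two norms enter only through their sum \<open>q\<close>.\<close>
  have "(of_int (k + 1 - ?a) * lam Hodge k + of_int ?a * real (card V)) * norm2 \<phi> =
    of_int ?a * real (card V) * norm2 \<phi> + of_int (k + 1 - ?a) * norm2 (cob k \<phi>)
      + (1 - of_int ?a) * norm2 (full_bd \<phi>) + of_int k * norm2 (full_bd \<phi>)"
    using arg_cong[OF q, of "\<lambda>x. of_int (k + 1 - ?a) * x"] by (simp add: algebra_simps)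
  also have "\<dots> \<le> (\<Sum>v\<in>V. inner_V (lap Hodge (k - 1) (contract v \<phi>)) (contract v \<phi>))"
    unfolding hodge_identity[OF \<phi>(1)]
    using sum_cobd_contract_ge[OF \<phi>(1), of ?a] alpha_le_facets cobd_support_missing[OF \<phi>(1)] by simp
  also have "\<dots> \<le> (\<Sum>v\<in>V. lam Hodge (k - 1) * norm2 (contract v \<phi>))"
    using assms by (intro sum_mono lam_bound faces_pred_nonempty c) auto
  also have "\<dots> = (of_int (k + 1) * lam Hodge (k - 1)) * norm2 \<phi>"
    using sum_norm2_contract_face[OF \<phi>(1)] by (simp flip: sum_distrib_left)
  finally show ?thesis using \<phi>(2) by (simp only: mult_le_cancel_right_pos)
qed

lemma mu_Hodge_ge:
  assumes "1 \<le> k" "faces S k \<noteq> {}"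
  shows "of_int (k + 1) * mu (k - 1)
    \<le> of_int (k + 1 - beta V S k) * mu k + of_int (beta V S k) * real (card V)"
proof -
  let ?b = "beta V S k"
  obtain \<phi> where \<phi>: "\<phi> \<in> ell2 (faces S k)" "norm2 \<phi> > 0"
      "lap Hodge k \<phi> = (\<lambda>\<tau>. mu k * \<phi> \<tau>)"
    by (rule mu_eigenfunction[OF assms(2)])
  have q: "norm2 (cob k \<phi>) + norm2 (full_bd \<phi>) = mu k * norm2 \<phi>"
    using inner_lap[OF \<phi>(1), of Hodge \<phi>] unfolding \<phi>(3) ell2_inner_linear by simp
  have c: "contract v \<phi> \<in> ell2 (faces S (k - 1))" for v
    using contract_closed[of \<phi> "k - 1"] \<phi>(1) by simp
  have "(of_int (k + 1) * mu (k - 1)) * norm2 \<phi> = (\<Sum>v\<in>V. mu (k - 1) * norm2 (contract v \<phi>))"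
    using sum_norm2_contract_face[OF \<phi>(1)] by (simp flip: sum_distrib_left)
  also have "\<dots> \<le> (\<Sum>v\<in>V. inner_V (lap Hodge (k - 1) (contract v \<phi>)) (contract v \<phi>))"
    using assms by (intro sum_mono mu_bound faces_pred_nonempty c) auto
  also have "\<dots> \<le> of_int ?b * real (card V) * norm2 \<phi> + of_int (k + 1 - ?b) * norm2 (cob k \<phi>)
      + (1 - of_int ?b) * norm2 (full_bd \<phi>) + of_int k * norm2 (full_bd \<phi>)"
    unfolding hodge_identity[OF \<phi>(1)]
    using sum_cobd_contract_le[OF \<phi>(1), of ?b] facets_le_beta cobd_support_missing[OF \<phi>(1)] by simp
  also have "\<dots> = (of_int (k + 1 - ?b) * mu k + of_int ?b * real (card V)) * norm2 \<phi>"
    using arg_cong[OF q, of "\<lambda>x. of_int (k + 1 - ?b) * x"] by (simp add: algebra_simps)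
  finally show ?thesis using \<phi>(2) by (simp only: mult_le_cancel_right_pos)
qed

section \<open>The upper Laplacian\<close>

text \<open>The Rayleigh bound is applied to \<open>\<psi>\<close> minus \<open>1/n\<close> times the coboundary of \<open>full_bd \<psi>\<close>,
  which has the same coboundary as \<open>\<psi>\<close> but a smaller norm.\<close>

lemma norm2_cob_le_lam_Up:
  assumes ne: "faces S k \<noteq> {}" and \<psi>: "\<psi> \<in> ell2 (faces S k)" and k: "k \<ge> 0"
  shows "norm2 (cob k \<psi>) \<le> lam Up k * (norm2 \<psi> - norm2 (full_bd \<psi>) / real (card V))"
proof -
  have "V \<noteq> {}"
  proof
    assume "V = {}"
    with ne faces_subset[of k] k show False by (auto simp: faces_def)
  qed
  then have n: "real (card V) > 0" using finite_V by (simp add: card_gt_0_iff)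
  define t where "t = 1 / real (card V)"
  have t: "t > 0" "t * real (card V) = 1" using n by (auto simp: t_def)
  define \<chi> where "\<chi> = cob (k - 1) (full_bd \<psi>)"
  have \<chi>: "\<chi> \<in> ell2 (faces S k)" using cob_closed[of "k - 1" "full_bd \<psi>"] by (simp add: \<chi>_def)
  then have t\<chi>: "(\<lambda>\<tau>. t * \<chi> \<tau>) \<in> ell2 (faces S k)" by (simp add: ell2_def)
  have "cob k \<chi> = (\<lambda>_. 0)" using cob_cob[of "k - 1" "full_bd \<psi>"] by (simp add: \<chi>_def)
  then have "cob k (\<lambda>\<tau>. \<psi> \<tau> - t * \<chi> \<tau>) = cob k \<psi>"
    using linear_op_diff[OF cob_linear \<psi> t\<chi>] linear_op_scale[OF cob_linear \<chi>, of t] by simp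
  moreover have "(\<lambda>\<tau>. \<psi> \<tau> - t * \<chi> \<tau>) \<in> ell2 (faces S k)" using \<psi> \<chi> by (simp add: ell2_def)
  ultimately have "norm2 (cob k \<psi>) \<le> lam Up k * norm2 (\<lambda>\<tau>. \<psi> \<tau> - t * \<chi> \<tau>)"
    using lam_bound[OF ne, of _ Up] inner_lap_up by (metis lap.simps(1))
  \<comment> \<open>Expanding gives |\<psi>|^2 - 2 t |d* \<psi>|^2 + t^2 |\<chi>|^2. Since the
    coboundary increases squared norms at most by the factor n, the last term is at most t^2 n |d*
    \<psi>|^2, and t = 1 / n turns it into half of the middle one.\<close>
  also have "norm2 (\<lambda>\<tau>. \<psi> \<tau> - t * \<chi> \<tau>) \<le> norm2 \<psi> - t * norm2 (full_bd \<psi>)"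
  proof -
    have "inner_V \<chi> \<psi> = norm2 (full_bd \<psi>)"
      unfolding \<chi>_def using inner_lap_down[OF \<psi>] by (simp add: lap_down_def)
    then have "norm2 (\<lambda>\<tau>. \<psi> \<tau> - t * \<chi> \<tau>) = norm2 \<psi> - 2 * (t * norm2 (full_bd \<psi>)) + t * (t * norm2 \<chi>)"
      by (simp add: ell2_inner_linear ell2_inner_commute[of _ \<psi> \<chi>] algebra_simps)
    moreover have "t * (t * norm2 \<chi>) \<le> t * norm2 (full_bd \<psi>)"
    proof (rule mult_left_mono)
      have "t * norm2 \<chi> \<le> t * (real (card V) * norm2 (full_bd \<psi>))"
        unfolding \<chi>_def using t by (intro mult_left_mono norm2_cob_le_card) auto
      then show "t * norm2 \<chi> \<le> norm2 (full_bd \<psi>)" using t(2) by (simp flip: mult.assoc)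
    qed (use t in simp)
    ultimately show ?thesis by linarith
  qed
  finally show ?thesis using lam_nonneg[OF ne, of Up] by (simp add: t_def mult_left_mono)
qed

text \<open>The refined Rayleigh bound is applied to every contraction of \<phi>; its gains add up
  to the term with \<open>of_int k\<close>. An arbitrary \<phi> is allowed because
  \<open>lam_Up_le\<close> inserts an eigenfunction in one case and a coboundary in the
  other.\<close>

lemma lam_Up_key:
  assumes "1 \<le> k" "faces S k \<noteq> {}" and \<phi>: "\<phi> \<in> ell2 (faces S k)"
  shows "of_int (alpha V S k) * real (card V) * norm2 \<phi>
      + of_int (k + 1 - alpha V S k) * norm2 (cob k \<phi>)
      + (1 - of_int (alpha V S k)) * norm2 (full_bd \<phi>)
    \<le> lam Up (k - 1) * (of_int (k + 1) * norm2 \<phi> - of_int k * norm2 (full_bd \<phi>) / real (card V))"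
proof -
  have c: "contract v \<phi> \<in> ell2 (faces S (k - 1))" for v
    using contract_closed[of \<phi> "k - 1"] \<phi> by simp
  have "of_int (alpha V S k) * real (card V) * norm2 \<phi>
      + of_int (k + 1 - alpha V S k) * norm2 (cob k \<phi>)
      + (1 - of_int (alpha V S k)) * norm2 (full_bd \<phi>)
    \<le> (\<Sum>v\<in>V. norm2 (cob (k - 1) (contract v \<phi>)))"
    using sum_cobd_contract_ge[OF \<phi>, of "alpha V S k"] alpha_le_facets cobd_support_missing[OF \<phi>] by simp
  also have "\<dots> \<le> (\<Sum>v\<in>V. lam Up (k - 1) *
      (norm2 (contract v \<phi>) - norm2 (full_bd (contract v \<phi>)) / real (card V)))"
    using assms by (intro sum_mono norm2_cob_le_lam_Up faces_pred_nonempty c) auto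
  also have "\<dots> = lam Up (k - 1) * (of_int (k + 1) * norm2 \<phi> - of_int k * norm2 (full_bd \<phi>) / real (card V))"
    using sum_norm2_contract_face[OF \<phi>] sum_norm2_bd_contract[OF \<phi>]
    by (simp add: sum_subtractf flip: sum_distrib_left sum_divide_distrib)
  finally show ?thesis .
qed

text \<open>At a facet of \<tau> the boundary of its indicator is a single sign. This provides test
  functions for the strict positivity of top eigenvalues.\<close>

lemma norm2_bd_indicator_pos:
  assumes "k \<ge> 0" "\<tau> \<in> faces S k"
  shows "norm2 (full_bd (indicator_fun \<tau>)) > 0"
proof -
  have V: "\<tau> \<subseteq> V" using assms(2) faces_subset by blast
  have "\<tau> \<noteq> {}" using assms by (auto simp: faces_def)
  then obtain v where v: "v \<in> \<tau>" by blast
  let ?\<rho> = "\<tau> - {v}"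
  have "full_bd (indicator_fun \<tau>) ?\<rho> =
      (\<Sum>w\<in>V - ?\<rho>. if w = v then of_int (s ?\<rho> \<tau>) else (0::real))"
  proof -
    have "of_int (s ?\<rho> (insert w ?\<rho>)) * indicator_fun \<tau> (insert w ?\<rho>) =
        (if w = v then of_int (s ?\<rho> \<tau>) else (0::real))" if "w \<in> V - ?\<rho>" for w
    proof (cases "w = v")
      case True
      then show ?thesis using v by (simp add: indicator_fun_def insert_absorb)
    next
      case False
      then have "insert w ?\<rho> \<noteq> \<tau>" using that by blast
      then show ?thesis using False by (simp add: indicator_fun_def)
    qed
    moreover have "?\<rho> \<subseteq> V" using V by blast
    ultimately show ?thesis unfolding full_bd_def by simp
  qed
  also have "\<dots> = of_int (s ?\<rho> \<tau>)" using finite_V V v by auto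
  finally have "full_bd (indicator_fun \<tau>) ?\<rho> \<noteq> (0::real)" using sign_square[OF V v] by auto
  moreover have "full_bd (indicator_fun \<tau>) \<in> ell2 (faces S (k - 1))"
    using full_bd_closed[of _ "k - 1"] indicator_in_ell2[OF assms(2)] by simp
  ultimately show ?thesis
    using norm2_eq_0 norm2_nonneg[of "full_bd (indicator_fun \<tau>)"] by (metis order_le_less)
qed

lemma lam_Down_pos:
  assumes "k \<ge> 0" "faces S k \<noteq> {}"
  shows "lam Down k > 0"
proof -
  obtain \<tau> where \<tau>: "\<tau> \<in> faces S k" using assms by blast
  have "norm2 (full_bd (indicator_fun \<tau>)) \<le> lam Down k * norm2 (indicator_fun \<tau>)"
    using lam_bound[OF assms(2) indicator_in_ell2[OF \<tau>], of Down]
      inner_lap_down[OF indicator_in_ell2[OF \<tau>], of "indicator_fun \<tau>"] by simp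
  then have "0 < lam Down k * norm2 (indicator_fun \<tau>)"
    using norm2_bd_indicator_pos[OF assms(1) \<tau>] by linarith
  then show ?thesis using norm2_nonneg[of "indicator_fun \<tau>"] by (simp add: zero_less_mult_iff)
qed

text \<open>If the top eigenvalue vanished, the boundary of an indicator would have coboundary zero
  in \<open>S\<close>, and by adjointness its own norm would be zero.\<close>

lemma lam_Up_pos:
  assumes "k \<ge> 0" "faces S k \<noteq> {}"
  shows "lam Up (k - 1) > 0"
proof (rule ccontr)
  assume "\<not> lam Up (k - 1) > 0"
  moreover have ne: "faces S (k - 1) \<noteq> {}" using assms by (rule faces_pred_nonempty)
  ultimately have 0: "lam Up (k - 1) = 0" using lam_nonneg[OF ne, of Up] by simp
  obtain \<tau> where \<tau>: "\<tau> \<in> faces S k" using assms by blast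
  let ?\<chi> = "full_bd (indicator_fun \<tau>) :: 'a set \<Rightarrow> real"
  have "?\<chi> \<in> ell2 (faces S (k - 1))"
    using full_bd_closed[of _ "k - 1"] indicator_in_ell2[OF \<tau>] by simp
  from lam_bound[OF ne this, of Up] have "norm2 (cob (k - 1) ?\<chi>) \<le> 0"
    by (simp add: inner_lap_up 0)
  then have "cob (k - 1) ?\<chi> = (\<lambda>_. 0)"
    using norm2_eq_0[OF cob_closed] norm2_nonneg by (metis order_antisym)
  then have "norm2 ?\<chi> = 0"
    using inner_lap_down[OF indicator_in_ell2[OF \<tau>], of "indicator_fun \<tau>"]
    by (simp add: lap_down_def ell2_inner_real)
  then show False using norm2_bd_indicator_pos[OF assms(1) \<tau>] by simp
qed

lemma lam_Up_le:
  assumes "1 \<le> k" "faces S k \<noteq> {}"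
  shows "of_int (k + 1 - alpha V S k) * lam Up k + of_int (alpha V S k) * real (card V)
    \<le> of_int (k + 1) * lam Up (k - 1)"
proof (cases "lam Up k = 0")
  case False
  obtain \<phi> where \<phi>: "\<phi> \<in> ell2 (faces S k)" "norm2 \<phi> > 0"
      "lap Up k \<phi> = (\<lambda>\<tau>. lam Up k * \<phi> \<tau>)"
    by (rule lam_eigenfunction[OF assms(2)])
  \<comment> \<open>A nonzero eigenvalue makes the eigenfunction a multiple of a boundary, so its
    own boundary vanishes.\<close>
  have "(\<lambda>\<tau>. lam Up k * full_bd \<phi> \<tau>) = full_bd (\<lambda>\<tau>. lam Up k * \<phi> \<tau>)"
    using linear_op_scale[OF full_bd_linear[of "k - 1"], of \<phi>] \<phi>(1) by simp
  also have "\<dots> = (\<lambda>_. 0)"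
    unfolding \<phi>(3)[symmetric] lap.simps lap_up_def by (rule full_bd_full_bd)
  finally have "full_bd \<phi> = (\<lambda>_. 0)" using False by (simp add: fun_eq_iff)
  then have d: "norm2 (full_bd \<phi>) = 0" by (simp add: ell2_inner_real)
  have a: "norm2 (cob k \<phi>) = lam Up k * norm2 \<phi>"
    using inner_lap_up[of k \<phi> \<phi>] \<phi>(3) by (simp add: ell2_inner_linear)
  have "(of_int (k + 1 - alpha V S k) * lam Up k + of_int (alpha V S k) * real (card V)) * norm2 \<phi>
      \<le> (of_int (k + 1) * lam Up (k - 1)) * norm2 \<phi>"
    using lam_Up_key[OF assms \<phi>(1)] unfolding a d by (simp add: algebra_simps)
  then show ?thesis using \<phi>(2) by (simp only: mult_le_cancel_right_pos)
next
  case True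
  define l where "l = lam Up (k - 1)"
  define n where "n = real (card V)"
  define a where "a = real_of_int (alpha V S k)"
  define K where "K = real_of_int k"
  have k0: "k \<ge> 0" using assms by simp
  have l: "l > 0" unfolding l_def using k0 assms(2) by (rule lam_Up_pos)
  obtain \<psi> where \<psi>: "\<psi> \<in> ell2 (faces S (k - 1))" "norm2 \<psi> > 0"
      "lap Up (k - 1) \<psi> = (\<lambda>\<tau>. l * \<psi> \<tau>)"
    unfolding l_def by (rule lam_eigenfunction[OF faces_pred_nonempty[OF k0 assms(2)]])
  \<comment> \<open>With this choice the coboundary term vanishes, the boundary is l \<psi>, and
    |\<phi>|^2 = l |\<psi>|^2, so that \<open>lam_Up_key\<close> becomes an inequality between
    numbers after division by l |\<psi>|^2.\<close>
  define \<phi> where "\<phi> = cob (k - 1) \<psi>"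
  have \<phi>: "\<phi> \<in> ell2 (faces S k)" using cob_closed[of "k - 1" \<psi>] by (simp add: \<phi>_def)
  have bd: "full_bd \<phi> = (\<lambda>\<tau>. l * \<psi> \<tau>)" using \<psi>(3) by (simp add: \<phi>_def lap_up_def)
  have N: "norm2 \<phi> = l * norm2 \<psi>"
    using inner_lap_up[of "k - 1" \<psi> \<psi>] \<psi>(3) by (simp add: \<phi>_def ell2_inner_linear)
  have "cob k \<phi> = (\<lambda>_. 0)" using cob_cob[of "k - 1" \<psi>] by (simp add: \<phi>_def)
  then have "a * n * (l * norm2 \<psi>) + (1 - a) * (l * (l * norm2 \<psi>))
    \<le> l * ((K + 1) * (l * norm2 \<psi>) - K * (l * (l * norm2 \<psi>)) / n)"
    using lam_Up_key[OF assms \<phi>]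
    unfolding N bd by (simp add: l_def n_def a_def K_def ell2_inner_linear ell2_inner_real)
  also have "a * n * (l * norm2 \<psi>) + (1 - a) * (l * (l * norm2 \<psi>)) = (a * n + (1 - a) * l) * (l * norm2 \<psi>)"
    by (simp add: algebra_simps)
  also have "l * ((K + 1) * (l * norm2 \<psi>) - K * (l * (l * norm2 \<psi>)) / n) =
      (l * ((K + 1) - K * l / n)) * (l * norm2 \<psi>)"
    by (simp add: algebra_simps)
  finally have key: "a * n + (1 - a) * l \<le> l * ((K + 1) - K * l / n)"
    using l \<psi>(2) by (simp only: mult_le_cancel_right_pos mult_pos_pos)
  have K: "K \<ge> 1" using assms by (simp add: K_def)
  have a: "a \<le> K + 1" using alpha_bounds(2)[of k] k0 by (simp add: a_def K_def)
  \<comment> \<open>For l \<ge> n the bound a \<le> K + 1 suffices. For l < n, multiplying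
    \<open>key\<close> by n turns it into (n - l) (a n - K l) \<le> 0, hence even a n \<le> K
    l.\<close>
  have "a * n \<le> (K + 1) * l"
  proof (cases "l \<ge> n")
    case True
    have "a * n \<le> (K + 1) * n" using a by (intro mult_right_mono) (auto simp: n_def)
    also have "\<dots> \<le> (K + 1) * l" using True K by (intro mult_left_mono) auto
    finally show ?thesis .
  next
    case False
    then have n: "n > 0" using l by linarith
    have "(a * n + (1 - a) * l) * n \<le> (l * ((K + 1) - K * l / n)) * n"
      using key n by (intro mult_right_mono) auto
    also have "\<dots> = l * ((K + 1) * n - K * l)" using n by (simp add: field_simps)
    finally have "(n - l) * (a * n - K * l) \<le> 0" by (simp add: algebra_simps)
    then have "a * n \<le> K * l" using False by (simp add: mult_le_0_iff)
    then show ?thesis using l by (simp add: algebra_simps)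
  qed
  then show ?thesis using True by (simp add: l_def n_def a_def K_def)
qed

section \<open>The lower Laplacian\<close>

text \<open>A map and its adjoint have equal norm: the top eigenvalue bounds the boundary by
  definition and is shown to bound the coboundary too. With \<chi> the coboundary of \<psi>,
  nonnegativity of |d* \<chi> - L \<psi>|^2 yields L |\<chi>|^2 \<le> L^2 |\<psi>|^2; the case L = 0
  needs its own argument.\<close>

lemma norm2_cob_le_lam_Down:
  assumes ne: "faces S k \<noteq> {}" and \<psi>: "\<psi> \<in> ell2 (faces S (k - 1))"
  shows "norm2 (cob (k - 1) \<psi>) \<le> lam Down k * norm2 \<psi>"
proof -
  let ?L = "lam Down k"
  let ?\<chi> = "cob (k - 1) \<psi>"
  have \<chi>: "?\<chi> \<in> ell2 (faces S k)" using cob_closed[of "k - 1" \<psi>] by simp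
  have b: "norm2 (full_bd ?\<chi>) \<le> ?L * norm2 ?\<chi>"
    using lam_bound[OF ne \<chi>, of Down] inner_lap_down[OF \<chi>] by simp
  have i: "inner_V (full_bd ?\<chi>) \<psi> = norm2 ?\<chi>"
    using inner_lap_up[of "k - 1" \<psi> \<psi>] by (simp add: lap_up_def)
  have "0 \<le> norm2 (\<lambda>\<tau>. full_bd ?\<chi> \<tau> - ?L * \<psi> \<tau>)" by (rule norm2_nonneg)
  also have "\<dots> = norm2 (full_bd ?\<chi>) - 2 * ?L * norm2 ?\<chi> + ?L * (?L * norm2 \<psi>)"
    unfolding ell2_inner_linear ell2_inner_commute[of _ \<psi> "full_bd ?\<chi>"] i
    by (simp add: algebra_simps)
  finally have *: "?L * norm2 ?\<chi> \<le> ?L * (?L * norm2 \<psi>)" using b by linarith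
  show ?thesis
  proof (cases "?L = 0")
    case True
    then have "full_bd ?\<chi> = (\<lambda>_. 0)"
      using b norm2_nonneg[of "full_bd ?\<chi>"] full_bd_closed[of ?\<chi> "k - 1"] \<chi>
      by (intro norm2_eq_0[of _ "k - 1"]) auto
    then show ?thesis using i True by (simp add: ell2_inner_real)
  next
    case False
    then have "?L > 0" using lam_nonneg[OF ne, of Down] by simp
    then show ?thesis using * by simp
  qed
qed

lemma lam_Down_le:
  assumes "1 \<le> k" "faces S k \<noteq> {}"
  shows "of_int (k + 1 - alpha V S k) * lam Down k + of_int (alpha V S k) * real (card V)
    \<le> of_int (k + 1) * lam Down (k - 1)"
proof -
  define l where "l = lam Down k"
  define n where "n = real (card V)"
  define a where "a = real_of_int (alpha V S k)"
  define K where "K = real_of_int k"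
  define L where "L = lam Down (k - 1)"
  have k0: "k \<ge> 0" using assms by simp
  have ne: "faces S (k - 1) \<noteq> {}" using k0 assms(2) by (rule faces_pred_nonempty)
  have l: "l > 0" unfolding l_def using k0 assms(2) by (rule lam_Down_pos)
  obtain \<phi> where \<phi>: "\<phi> \<in> ell2 (faces S k)" "norm2 \<phi> > 0"
      "lap Down k \<phi> = (\<lambda>\<tau>. l * \<phi> \<tau>)"
    unfolding l_def by (rule lam_eigenfunction[OF assms(2)])
  \<comment> \<open>The boundary of \<phi> is an eigenfunction of the upper Laplacian in dimension k
    - 1 for the same eigenvalue, and its own boundary is zero.\<close>
  define \<chi> where "\<chi> = full_bd \<phi>"
  have \<chi>: "\<chi> \<in> ell2 (faces S (k - 1))" using full_bd_closed[of \<phi> "k - 1"] \<phi>(1) by (simp add: \<chi>_def)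
  have cob: "cob (k - 1) \<chi> = (\<lambda>\<tau>. l * \<phi> \<tau>)" using \<phi>(3) by (simp add: \<chi>_def lap_down_def)
  have N: "norm2 \<chi> = l * norm2 \<phi>"
    using inner_lap_down[OF \<phi>(1), of \<phi>] \<phi>(3) by (simp add: \<chi>_def ell2_inner_linear)
  then have Npos: "norm2 \<chi> > 0" using l \<phi>(2) by simp
  have c: "norm2 (cob (k - 1) \<chi>) = l * norm2 \<chi>"
    unfolding cob N by (simp add: ell2_inner_linear)
  have d: "norm2 (full_bd \<chi>) = 0"
    unfolding \<chi>_def full_bd_full_bd by (simp add: ell2_inner_real)
  \<comment> \<open>The index of \<open>alpha\<close> stays k although the facets have dimension k -
    1. This needs more than a facet in \<open>S\<close>: that facet must lie in a k-face, which
    holds because \<chi> is a boundary of a function on k-faces.\<close>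
  have facets: "alpha V S k + 1 \<le> int (facets_in (faces S (k - 1)) \<sigma>)"
    if \<sigma>: "\<sigma> \<subseteq> V" "\<sigma> \<notin> faces S k" and nz: "full_cobd \<chi> \<sigma> \<noteq> 0" for \<sigma>
  proof -
    obtain w where w: "w \<in> \<sigma>" "\<chi> (\<sigma> - {w}) \<noteq> 0" by (rule full_cobd_nonzeroD[OF nz])
    obtain x where x: "x \<notin> \<sigma> - {w}" "\<phi> (insert x (\<sigma> - {w})) \<noteq> 0"
      by (rule full_bd_nonzeroD[OF w(2)[unfolded \<chi>_def]])
    then have "insert x (\<sigma> - {w}) \<in> faces S k" using ell2_D[OF \<phi>(1)] by blast
    then show ?thesis using alpha_le_facets_pred[OF \<sigma> w(1) x(1)] by blast
  qed
  have contr: "contract v \<chi> \<in> ell2 (faces S (k - 1 - 1))" for v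
    using contract_closed[of \<chi> "k - 1 - 1"] \<chi> by simp
  \<comment> \<open>Working in dimension k - 1 turns the usual coefficient k + 1 - a into K - a, and
    the same shift occurs on the right. One copy of l and of L is thus still missing.\<close>
  have "(a * n + (K - a) * l) * norm2 \<chi> \<le> (\<Sum>v\<in>V. norm2 (cob (k - 1 - 1) (contract v \<chi>)))"
    using sum_cobd_contract_ge[OF \<chi>, of "alpha V S k"] facets unfolding c d
    by (simp add: a_def n_def K_def algebra_simps)
  also have "\<dots> \<le> (\<Sum>v\<in>V. L * norm2 (contract v \<chi>))"
    unfolding L_def by (intro sum_mono norm2_cob_le_lam_Down ne contr)
  also have "\<dots> = (K * L) * norm2 \<chi>"
    using sum_norm2_contract_face[OF \<chi>] by (simp add: K_def flip: sum_distrib_left)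
  finally have 1: "a * n + (K - a) * l \<le> K * L" using Npos by (simp only: mult_le_cancel_right_pos)
  \<comment> \<open>From l \<le> n and a \<ge> 0 the inequality \<open>1\<close> yields l \<le> L;
    adding this to \<open>1\<close> restores the missing copies.\<close>
  have "l * norm2 \<chi> \<le> n * norm2 \<chi>" unfolding c[symmetric] n_def by (rule norm2_cob_le_card)
  then have ln: "l \<le> n" using Npos by simp
  have "a \<ge> 0" using alpha_bounds(1)[of k] k0 by (simp add: a_def)
  then have "a * l \<le> a * n" using ln by (rule mult_left_mono[rotated])
  then have "K * l \<le> K * L" using 1 by (simp add: algebra_simps)
  then have "l \<le> L" using assms(1) by (simp add: K_def)
  then have "a * n + (K + 1 - a) * l \<le> (K + 1) * L" using 1 by (simp add: algebra_simps)
  then show ?thesis by (simp add: l_def n_def a_def K_def L_def algebra_simps)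
qed

theorem lam_le:
  assumes "1 \<le> k" "faces S k \<noteq> {}"
  shows "of_int (k + 1 - alpha V S k) * lam c k + of_int (alpha V S k) * real (card V)
    \<le> of_int (k + 1) * lam c (k - 1)"
  using lam_Up_le[OF assms] lam_Down_le[OF assms] lam_Hodge_le[OF assms] by (cases c) auto

end

section \<open>Coboundary operators and their signs\<close>

lemma conjugate_one: "conjugate 1 = (1 :: 'f::conjugatable_field)"
proof -
  have "conjugate 1 * conjugate 1 = (conjugate 1 * 1 :: 'f)"
    using conjugate_dist_mul[of 1 "1 :: 'f"] by simp
  moreover have "conjugate 1 \<noteq> (0 :: 'f)" by simp
  ultimately show ?thesis using mult_left_cancel by blast
qed

lemma conjugate_of_int: "conjugate (of_int z) = (of_int z :: 'f::conjugatable_field)"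
proof -
  have nat: "conjugate (of_nat n) = (of_nat n :: 'f)" for n
    by (induction n) (simp_all add: conjugate_dist_add conjugate_one)
  show ?thesis
    by (cases z rule: int_cases2) (simp_all add: nat conjugate_neg)
qed

text \<open>Reading the dimension off the cardinality gives one sign function for all indices. The
  field values 1 and -1 are turned into integers to match \<open>signed_simplex\<close>.\<close>

definition sign_of :: "(int \<Rightarrow> ('a, 'f::conjugatable_field) operator) \<Rightarrow> 'a set \<Rightarrow> 'a set \<Rightarrow> int" where
  "sign_of D \<tau> \<sigma> =
    (let z = D (int (card \<tau>) - 1) (indicator_fun \<tau>) \<sigma>
     in if z = 1 then 1 else if z = -1 then -1 else 0)"

lemma coboundary_opsD:
  assumes "coboundary_ops S D" "k \<ge> -1"
  shows "linear_op (faces S k) (faces S (k + 1)) (D k)"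
    and "\<phi> \<in> ell2 (faces S k) \<Longrightarrow> D (k + 1) (D k \<phi>) = (\<lambda>_. 0)"
    and "\<tau> \<in> faces S k \<Longrightarrow> \<sigma> \<in> faces S (k + 1) \<Longrightarrow> D k (indicator_fun \<tau>) \<sigma> \<in> {1, -1, 0}"
    and "\<tau> \<in> faces S k \<Longrightarrow> \<sigma> \<in> faces S (k + 1) \<Longrightarrow> D k (indicator_fun \<tau>) \<sigma> \<noteq> 0 \<longleftrightarrow> \<tau> \<prec> \<sigma>"
  using assms unfolding coboundary_ops_def by blast+

context
  fixes V :: "'a set" and D :: "int \<Rightarrow> ('a, 'f::{conjugatable_field, ring_char_0}) operator"
  assumes fin: "finite V" and D: "coboundary_ops (Pow V) D"
begin

lemma finite_faces_Pow: "finite (faces (Pow V) k)"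
  by (rule finite_subset[of _ "Pow V"]) (auto simp: faces_def fin)

lemma face_insert_Pow:
  assumes "\<tau> \<in> faces (Pow V) k" "v \<in> V - \<tau>"
  shows "insert v \<tau> \<in> faces (Pow V) (k + 1)"
  using assms fin finite_subset[of \<tau> V] by (auto simp: faces_def)

lemma face_remove_Pow:
  assumes "\<sigma> \<in> faces (Pow V) (k + 1)" "v \<in> \<sigma>"
  shows "\<sigma> - {v} \<in> faces (Pow V) k"
  using assms card_Suc_Diff1[of \<sigma> v] fin finite_subset[of \<sigma> V] by (auto simp: faces_def)

lemma sign_of_eq:
  assumes "k \<ge> -1" "\<tau> \<in> faces (Pow V) k" "\<sigma> \<in> faces (Pow V) (k + 1)"
  shows "of_int (sign_of D \<tau> \<sigma>) = D k (indicator_fun \<tau>) \<sigma>"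
proof -
  have "int (card \<tau>) - 1 = k" using assms(2) by (simp add: faces_def)
  then show ?thesis
    using coboundary_opsD(3)[OF D assms] by (auto simp: sign_of_def)
qed

lemma D_expand:
  assumes k: "k \<ge> -1" and \<phi>: "\<phi> \<in> ell2 (faces (Pow V) k)" and \<sigma>: "\<sigma> \<in> faces (Pow V) (k + 1)"
  shows "D k \<phi> \<sigma> = (\<Sum>v\<in>\<sigma>. of_int (sign_of D (\<sigma> - {v}) \<sigma>) * \<phi> (\<sigma> - {v}))"
proof -
  have "D k \<phi> \<sigma> = (\<Sum>\<tau>\<in>faces (Pow V) k. \<phi> \<tau> * D k (indicator_fun \<tau>) \<sigma>)"
    by (rule linear_op_expand[OF finite_faces_Pow coboundary_opsD(1)[OF D k] \<phi>])
  also have "\<dots> = (\<Sum>\<tau>\<in>(\<lambda>v. \<sigma> - {v}) ` \<sigma>. \<phi> \<tau> * D k (indicator_fun \<tau>) \<sigma>)"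
  proof (rule sum.mono_neutral_right[OF finite_faces_Pow])
    show "(\<lambda>v. \<sigma> - {v}) ` \<sigma> \<subseteq> faces (Pow V) k" using face_remove_Pow[OF \<sigma>] by blast
    show "\<forall>\<tau>\<in>faces (Pow V) k - (\<lambda>v. \<sigma> - {v}) ` \<sigma>. \<phi> \<tau> * D k (indicator_fun \<tau>) \<sigma> = 0"
    proof
      fix \<tau> assume \<tau>: "\<tau> \<in> faces (Pow V) k - (\<lambda>v. \<sigma> - {v}) ` \<sigma>"
      have "\<not> \<tau> \<prec> \<sigma>"
      proof
        assume "\<tau> \<prec> \<sigma>"
        then obtain v where "\<tau> \<subseteq> \<sigma>" "\<sigma> - \<tau> = {v}"
          unfolding covered_def using card_1_singletonE by metis
        then have "v \<in> \<sigma>" "\<tau> = \<sigma> - {v}" by auto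
        with \<tau> show False by blast
      qed
      then show "\<phi> \<tau> * D k (indicator_fun \<tau>) \<sigma> = 0"
        using coboundary_opsD(4)[OF D k _ \<sigma>, of \<tau>] \<tau> by simp
    qed
  qed
  also have "\<dots> = (\<Sum>v\<in>\<sigma>. \<phi> (\<sigma> - {v}) * D k (indicator_fun (\<sigma> - {v})) \<sigma>)"
    by (subst sum.reindex) (auto intro: inj_onI)
  also have "\<dots> = (\<Sum>v\<in>\<sigma>. of_int (sign_of D (\<sigma> - {v}) \<sigma>) * \<phi> (\<sigma> - {v}))"
    using face_remove_Pow[OF \<sigma>] sign_of_eq[OF k _ \<sigma>] by (intro sum.cong) (auto simp: mult.commute)
  finally show ?thesis .
qed

text \<open>The anticommutation rule is the vanishing squared coboundary of the indicator of \<tau>,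
  evaluated at \<tau> with \<open>v\<close> and \<open>w\<close> added: exactly two simplices lie
  strictly between these.\<close>

lemma signed_simplex_sign_of: "signed_simplex V (sign_of D)"
proof
  show "finite V" by (rule fin)
next
  fix \<sigma> v assume \<sigma>: "\<sigma> \<subseteq> V" and v: "v \<in> \<sigma>"
  define k where "k = int (card (\<sigma> - {v})) - 1"
  have finS: "finite \<sigma>" using \<sigma> fin finite_subset by blast
  have k: "k \<ge> -1" "\<sigma> - {v} \<in> faces (Pow V) k" "\<sigma> \<in> faces (Pow V) (k + 1)"
    using \<sigma> card_Suc_Diff1[OF finS v] by (auto simp: faces_def k_def)
  have "\<sigma> - {v} \<prec> \<sigma>" using v by (auto simp: covered_def double_diff)
  then have "D k (indicator_fun (\<sigma> - {v})) \<sigma> \<in> {1, -1}"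
    using coboundary_opsD(3,4)[OF D k] by blast
  then show "sign_of D (\<sigma> - {v}) \<sigma> * sign_of D (\<sigma> - {v}) \<sigma> = 1"
    by (auto simp: sign_of_def k_def)
next
  fix \<tau> v w assume \<tau>: "\<tau> \<subseteq> V" and v: "v \<in> V - \<tau>" and w: "w \<in> V - \<tau>" and vw: "v \<noteq> w"
  define k where "k = int (card \<tau>) - 1"
  let ?\<sigma> = "insert w (insert v \<tau>)"
  let ?s = "\<lambda>\<tau> \<sigma>. of_int (sign_of D \<tau> \<sigma>) :: 'f"
  have k: "k \<ge> -1" "k + 1 \<ge> -1" by (auto simp: k_def)
  have \<tau>F: "\<tau> \<in> faces (Pow V) k" using \<tau> by (simp add: faces_def k_def)
  have vF: "insert v \<tau> \<in> faces (Pow V) (k + 1)" and wF: "insert w \<tau> \<in> faces (Pow V) (k + 1)"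
    using face_insert_Pow[OF \<tau>F] v w by auto
  have \<sigma>F: "?\<sigma> \<in> faces (Pow V) (k + 1 + 1)" using face_insert_Pow[OF vF] w vw by blast
  have ind: "indicator_fun \<tau> \<in> (ell2 (faces (Pow V) k) :: ('a set \<Rightarrow> 'f) set)"
    by (rule indicator_in_ell2[OF \<tau>F])
  let ?\<phi> = "D k (indicator_fun \<tau>)"
  have \<phi>: "?\<phi> \<in> ell2 (faces (Pow V) (k + 1))"
    by (rule linear_op_closed[OF coboundary_opsD(1)[OF D k(1)] ind])
  have "0 = D (k + 1) ?\<phi> ?\<sigma>" using coboundary_opsD(2)[OF D k(1) ind] by simp
  also have "\<dots> = (\<Sum>u\<in>?\<sigma>. ?s (?\<sigma> - {u}) ?\<sigma> * ?\<phi> (?\<sigma> - {u}))"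
    by (rule D_expand[OF k(2) \<phi> \<sigma>F])
  also have "\<dots> = (\<Sum>u\<in>{v, w}. ?s (?\<sigma> - {u}) ?\<sigma> * ?\<phi> (?\<sigma> - {u}))"
  proof (rule sum.mono_neutral_right)
    show "finite ?\<sigma>" using \<tau> fin finite_subset by simp
    show "\<forall>u\<in>?\<sigma> - {v, w}. ?s (?\<sigma> - {u}) ?\<sigma> * ?\<phi> (?\<sigma> - {u}) = 0"
    proof
      fix u assume u: "u \<in> ?\<sigma> - {v, w}"
      then have "\<not> \<tau> \<prec> ?\<sigma> - {u}" by (auto simp: covered_def)
      moreover have "?\<sigma> - {u} \<in> faces (Pow V) (k + 1)"
        using face_remove_Pow[OF \<sigma>F] u by blast
      ultimately show "?s (?\<sigma> - {u}) ?\<sigma> * ?\<phi> (?\<sigma> - {u}) = 0"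
        using coboundary_opsD(4)[OF D k(1) \<tau>F, of "?\<sigma> - {u}"] by simp
    qed
  qed auto
  also have "\<dots> = ?s (insert w \<tau>) ?\<sigma> * ?s \<tau> (insert w \<tau>) + ?s (insert v \<tau>) ?\<sigma> * ?s \<tau> (insert v \<tau>)"
  proof -
    have "?\<sigma> - {v} = insert w \<tau>" "?\<sigma> - {w} = insert v \<tau>" using v w vw by auto
    then show ?thesis
      using vw sign_of_eq[OF k(1) \<tau>F vF] sign_of_eq[OF k(1) \<tau>F wF] by simp
  qed
  finally have "of_int (sign_of D \<tau> (insert v \<tau>) * sign_of D (insert v \<tau>) ?\<sigma>
      + sign_of D \<tau> (insert w \<tau>) * sign_of D (insert w \<tau>) ?\<sigma>) = (0 :: 'f)"
    by (simp add: algebra_simps)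
  \<comment> \<open>Characteristic zero makes \<open>of_int\<close> injective, so the relation in
    the field descends to the integers.\<close>
  then show "sign_of D \<tau> (insert v \<tau>) * sign_of D (insert v \<tau>) (insert w (insert v \<tau>)) =
      - (sign_of D \<tau> (insert w \<tau>) * sign_of D (insert w \<tau>) (insert v (insert w \<tau>)))"
    unfolding of_int_eq_0_iff by (simp add: insert_commute)
qed

context
  fixes S :: "'a set set"
  assumes S: "simplicial_complex_on V S"
begin

interpretation signed_complex V "sign_of D" S
  using signed_simplex_sign_of S by (simp add: signed_complex_def signed_complex_axioms_def)

lemma cobd_eq:
  assumes k: "k \<ge> -1" and \<phi>: "\<phi> \<in> ell2 (faces S k)"
  shows "cobd D S k \<phi> = cob k \<phi>"
proof -
  have sub: "faces S j \<subseteq> faces (Pow V) j" for j using S_subset by (auto simp: faces_def)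
  then have "\<phi> \<in> ell2 (faces (Pow V) k)" using \<phi> by (auto simp: ell2_def)
  from D_expand[OF k this] have "D k \<phi> \<sigma> = full_cobd \<phi> \<sigma>" if "\<sigma> \<in> faces S (k + 1)" for \<sigma>
    using that sub[of "k + 1"] by (auto simp: full_cobd_def faces_def)
  then show ?thesis by (auto simp: cobd_def cob_def restr_def)
qed

text \<open>Integer signs are fixed by conjugation, so the adjoint is \<open>full_bd\<close> over
  complex scalars as well.\<close>

lemma ell2_inner_cob:
  assumes \<phi>: "\<phi> \<in> ell2 (faces S k)" and \<psi>: "\<psi> \<in> ell2 (faces S (k + 1))"
  shows "ell2_inner (faces S (k + 1)) (cob k \<phi>) \<psi> = ell2_inner (faces S k) \<phi> (full_bd \<psi> :: 'a set \<Rightarrow> 'f)"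
proof -
  have "ell2_inner (faces S (k + 1)) (cob k \<phi>) \<psi> =
      (\<Sum>\<sigma>\<in>faces S (k + 1). full_cobd \<phi> \<sigma> * conjugate (\<psi> \<sigma>))"
    by (simp add: ell2_inner_def cob_def restr_def)
  also have "\<dots> = (\<Sum>\<sigma>\<in>Pow V. full_cobd \<phi> \<sigma> * conjugate (\<psi> \<sigma>))"
    using ell2_D[OF \<psi>] faces_subset fin by (intro sum.mono_neutral_left) auto
  also have "\<dots> = (\<Sum>\<tau>\<in>Pow V. \<phi> \<tau> * full_bd (\<lambda>\<sigma>. conjugate (\<psi> \<sigma>)) \<tau>)"
    by (rule full_cobd_adjoint_sum)
  also have "\<dots> = (\<Sum>\<tau>\<in>Pow V. \<phi> \<tau> * conjugate (full_bd \<psi> \<tau>))"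
    using fin by (simp add: full_bd_def sum_conjugate conjugate_dist_mul conjugate_of_int)
  also have "\<dots> = ell2_inner (faces S k) \<phi> (full_bd \<psi>)"
    unfolding ell2_inner_def
    using ell2_D[OF \<phi>] faces_subset fin by (intro sum.mono_neutral_right) auto
  finally show ?thesis .
qed

text \<open>Pairing with indicator functions recovers every value of a candidate, which gives the
  uniqueness demanded by the definite description in \<open>adjoint_op\<close>.\<close>

lemma bd_eq:
  assumes k: "k \<ge> -1" and \<psi>: "\<psi> \<in> ell2 (faces S (k + 1))"
  shows "bd D S k \<psi> = full_bd \<psi>"
  unfolding bd_def adjoint_op_def
proof (rule the_equality)
  show *: "full_bd \<psi> \<in> ell2 (faces S k) \<and>
      (\<forall>\<phi>\<in>ell2 (faces S k). ell2_inner (faces S (k + 1)) (cobd D S k \<phi>) \<psi> =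
        ell2_inner (faces S k) \<phi> (full_bd \<psi>))"
    using full_bd_closed[OF \<psi>] ell2_inner_cob[OF _ \<psi>] cobd_eq[OF k] by simp
  fix \<chi> assume \<chi>: "\<chi> \<in> ell2 (faces S k) \<and>
      (\<forall>\<phi>\<in>ell2 (faces S k). ell2_inner (faces S (k + 1)) (cobd D S k \<phi>) \<psi> =
        ell2_inner (faces S k) \<phi> \<chi>)"
  show "\<chi> = full_bd \<psi>"
  proof
    fix \<tau>
    show "\<chi> \<tau> = full_bd \<psi> \<tau>"
    proof (cases "\<tau> \<in> faces S k")
      case True
      have i: "ell2_inner (faces S k) (indicator_fun \<tau>) f = conjugate (f \<tau>)" for f :: "'a set \<Rightarrow> 'f"
        unfolding ell2_inner_def indicator_fun_def using finite_faces[of k] True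
        by (simp add: if_distrib[of "\<lambda>x. x * _"] cong: if_cong)
      have "conjugate (\<chi> \<tau>) = conjugate (full_bd \<psi> \<tau>)"
        using * \<chi> indicator_in_ell2[OF True] unfolding i[symmetric] by metis
      then show ?thesis by simp
    next
      case False
      then show ?thesis using * \<chi> by (simp add: ell2_def)
    qed
  qed
qed

text \<open>The bound k \<ge> 0 reflects that the lower Laplacian uses the coboundary of index k -
  1, which must be at least -1.\<close>

lemma laplacian_eq:
  assumes k: "k \<ge> 0" and \<phi>: "\<phi> \<in> ell2 (faces S k)"
  shows "laplacian D S c k \<phi> = lap c k \<phi>"
proof -
  have up: "laplacian_up D S k \<phi> = lap_up k \<phi>"
    using k \<phi> by (simp add: laplacian_up_def lap_up_def cobd_eq bd_eq cob_closed)
  have "full_bd \<phi> \<in> ell2 (faces S (k - 1))" using full_bd_closed[of \<phi> "k - 1"] \<phi> by simp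
  then have down: "laplacian_down D S k \<phi> = lap_down k \<phi>"
    using k \<phi> bd_eq[of "k - 1" \<phi>] cobd_eq[of "k - 1" "full_bd \<phi>"]
    by (simp add: laplacian_down_def lap_down_def)
  show ?thesis using up down by (cases c) simp_all
qed

lemma laplacian_spectrum_eq:
  assumes "k \<ge> 0"
  shows "laplacian_spectrum D S c k = {z. \<exists>\<phi>. eigenfunction (faces S k) (lap c k) z \<phi>}"
proof -
  have "laplacian_spectrum D S c k = spectrum_op (faces S k) (lap c k)"
    unfolding laplacian_spectrum_def spectrum_op_def
    using laplacian_eq[OF assms] by (intro Collect_cong arg_cong[of _ _ Not] bij_betw_cong) simp
  then show ?thesis by (simp add: spectrum_op_eigenfunction[OF finite_faces lap_linear])
qed

end

end

section \<open>Reduction of complex to real scalars\<close>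

context signed_complex
begin

text \<open>The Laplacians have integer coefficients, so any additive map commuting with integer
  multiples passes through them. It is used for real and imaginary parts.\<close>

lemma lap_morphism:
  fixes h :: "'f::conjugatable_field \<Rightarrow> 'g::conjugatable_field"
  assumes zero: "h 0 = 0" and add: "\<And>x y. h (x + y) = h x + h y"
    and scale: "\<And>z x. h (of_int z * x) = of_int z * h x"
  shows "(\<lambda>\<tau>. h (lap c k \<phi> \<tau>)) = lap c k (\<lambda>\<tau>. h (\<phi> \<tau>))"
proof -
  have sum: "h (sum f I) = (\<Sum>i\<in>I. h (f i))" for f :: "'a \<Rightarrow> 'f" and I
    using sum_comp_morphism[of h f I] zero add by (simp add: o_def)
  have bd: "(\<lambda>\<tau>. h (full_bd \<phi> \<tau>)) = full_bd (\<lambda>\<tau>. h (\<phi> \<tau>))" for \<phi>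
    by (simp add: fun_eq_iff full_bd_def sum scale zero)
  have cob: "(\<lambda>\<tau>. h (cob j \<phi> \<tau>)) = cob j (\<lambda>\<tau>. h (\<phi> \<tau>))" for \<phi> j
    by (simp add: fun_eq_iff cob_def restr_def full_cobd_def sum scale zero)
  have up: "(\<lambda>\<tau>. h (lap_up k \<phi> \<tau>)) = lap_up k (\<lambda>\<tau>. h (\<phi> \<tau>))"
    unfolding lap_up_def bd cob ..
  have down: "(\<lambda>\<tau>. h (lap_down k \<phi> \<tau>)) = lap_down k (\<lambda>\<tau>. h (\<phi> \<tau>))"
    unfolding lap_down_def cob bd ..
  show ?thesis
    using up down by (cases c) (simp_all add: add fun_eq_iff)
qed

lemma lap_Re: "(\<lambda>\<tau>. Re (lap c k \<phi> \<tau>)) = lap c k (\<lambda>\<tau>. Re (\<phi> \<tau>))"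
  by (rule lap_morphism) simp_all

lemma lap_Im: "(\<lambda>\<tau>. Im (lap c k \<phi> \<tau>)) = lap c k (\<lambda>\<tau>. Im (\<phi> \<tau>))"
  by (rule lap_morphism) simp_all

lemma Re_complex_eigenvalues:
  "Re ` {z :: complex. \<exists>\<phi>. eigenfunction (faces S k) (lap c k) z \<phi>} =
    {r :: real. \<exists>\<phi>. eigenfunction (faces S k) (lap c k) r \<phi>}"
proof (intro equalityI subsetI)
  fix r assume "r \<in> Re ` {z :: complex. \<exists>\<phi>. eigenfunction (faces S k) (lap c k) z \<phi>}"
  then obtain z \<phi> where z: "r = Re z" and \<phi>: "\<phi> \<in> ell2 (faces S k)" "\<phi> \<noteq> (\<lambda>_. 0)"
      "lap c k \<phi> = (\<lambda>\<tau>. z * \<phi> \<tau>)"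
    unfolding eigenfunction_def by blast
  define u where "u \<tau> = Re (\<phi> \<tau>)" for \<tau>
  define v where "v \<tau> = Im (\<phi> \<tau>)" for \<tau>
  define b where "b = Im z"
  let ?ip = "ell2_inner (faces S k)"
  have uv: "u \<in> ell2 (faces S k)" "v \<in> ell2 (faces S k)"
    using \<phi>(1) by (auto simp: u_def v_def ell2_def)
  have lu: "lap c k u = (\<lambda>\<tau>. r * u \<tau> - b * v \<tau>)"
    using lap_Re[of c k \<phi>] by (simp add: \<phi>(3) u_def[abs_def] v_def b_def z)
  \<comment> \<open>The double negation gives this the shape of a difference, as
    \<open>ell2_inner_diff_right\<close> expects.\<close>
  have lv: "lap c k v = (\<lambda>\<tau>. r * v \<tau> - - b * u \<tau>)"
    using lap_Im[of c k \<phi>] by (simp add: \<phi>(3) u_def v_def[abs_def] b_def z)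
  have nz: "u \<noteq> (\<lambda>_. 0) \<or> v \<noteq> (\<lambda>_. 0)"
    using \<phi>(2) by (auto simp: u_def v_def fun_eq_iff complex_eq_iff)
  \<comment> \<open>Symmetry compares r <u, v> - b |v|^2 with r <u, v> + b |u|^2 and so forces the
    imaginary part b to vanish. Then whichever of \<open>u\<close> and \<open>v\<close> is nonzero
    is a real eigenfunction for \<open>r\<close>.\<close>
  have "?ip (lap c k u) v = ?ip u (lap c k v)" by (rule lap_symmetric[OF uv])
  then have "b * (?ip u u + ?ip v v) = 0"
    unfolding lu lv ell2_inner_linear by (simp add: algebra_simps)
  moreover have "?ip u u + ?ip v v > 0"
    using nz ell2_inner_self_pos[OF finite_faces uv(1)] ell2_inner_self_pos[OF finite_faces uv(2)]
      ell2_inner_self_nonneg[of "faces S k" u] ell2_inner_self_nonneg[of "faces S k" v]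
    by linarith
  ultimately have "b = 0" by simp
  then show "r \<in> {r. \<exists>\<phi>. eigenfunction (faces S k) (lap c k) r \<phi>}"
    using nz lu lv uv by (auto simp: eigenfunction_def)
next
  fix r assume "r \<in> {r :: real. \<exists>\<phi>. eigenfunction (faces S k) (lap c k) r \<phi>}"
  then obtain \<phi> where \<phi>: "\<phi> \<in> ell2 (faces S k)" "\<phi> \<noteq> (\<lambda>_. 0)" "lap c k \<phi> = (\<lambda>\<tau>. r * \<phi> \<tau>)"
    unfolding eigenfunction_def by blast
  let ?\<psi> = "\<lambda>\<tau>. complex_of_real (\<phi> \<tau>)"
  \<comment> \<open>Handles the imaginary part of \<open>?\<psi>\<close>, which is the zero
    function.\<close>
  have "lap c k (\<lambda>_. 0) = (\<lambda>_. 0 :: real)" by (rule linear_op_zero[OF lap_linear])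
  then have "lap c k ?\<psi> = (\<lambda>\<tau>. complex_of_real r * ?\<psi> \<tau>)"
    using lap_Re[of c k ?\<psi>] lap_Im[of c k ?\<psi>] \<phi>(3) by (simp add: fun_eq_iff complex_eq_iff)
  then have "eigenfunction (faces S k) (lap c k) (complex_of_real r) ?\<psi>"
    using \<phi>(1,2) by (simp add: eigenfunction_def ell2_def fun_eq_iff)
  then show "r \<in> Re ` {z. \<exists>\<phi>. eigenfunction (faces S k) (lap c k) z \<phi>}"
    by (intro image_eqI[of _ _ "complex_of_real r"]) auto
qed

end

text \<open>A simplex of maximal dimension contains subsets of every smaller cardinality, and these
  belong to \<open>S\<close>.\<close>

lemma faces_nonempty:
  assumes "finite V" "simplicial_complex_on V S" "0 \<le> k" "k \<le> complex_dim S"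
  shows "faces S k \<noteq> {}"
proof -
  have "S \<noteq> {}" using assms(3,4) by (auto simp: complex_dim_def)
  then obtain \<sigma>0 where "\<sigma>0 \<in> faces S (int (card \<sigma>0) - 1)" by (auto simp: faces_def)
  then have ne: "{k. faces S k \<noteq> {}} \<noteq> {}" by blast
  have "S \<subseteq> Pow V" using assms(2) by (simp add: simplicial_complex_on_def)
  then have "finite S" using assms(1) finite_subset by blast
  moreover have "{k. faces S k \<noteq> {}} \<subseteq> (\<lambda>\<sigma>. int (card \<sigma>) - 1) ` S"
    by (force simp: faces_def)
  ultimately have "finite {k. faces S k \<noteq> {}}" using finite_surj by blast
  from Max_in[OF this ne] obtain \<sigma> where \<sigma>: "\<sigma> \<in> S" "int (card \<sigma>) = complex_dim S + 1"
    using \<open>S \<noteq> {}\<close> by (auto simp: complex_dim_def faces_def)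
  then have "nat (k + 1) \<le> card \<sigma>" using assms(4) by linarith
  then obtain \<tau> where "\<tau> \<subseteq> \<sigma>" "card \<tau> = nat (k + 1)"
    by (rule obtain_subset_with_card_n)
  then have "\<tau> \<in> faces S k"
    using \<sigma>(1) assms(2,3) by (auto simp: faces_def simplicial_complex_on_def)
  then show ?thesis by blast
qed

theorem theorem4p1:
  fixes V :: "'a set" and S :: "'a set set" and k :: int and c :: laplacian_kind
    and D :: "int \<Rightarrow> ('a, real) operator" and E :: "int \<Rightarrow> ('a, complex) operator"
  assumes "finite V" and "simplicial_complex_on V S"
    and "coboundary_ops (Pow V) D" and "coboundary_ops (Pow V) E"
    and "1 \<le> k" and "k \<le> complex_dim S"
  shows "(real_of_int (k + 1 - alpha V S k) * lambda_real D S c k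
           + real_of_int (alpha V S k) * real (card V)
         \<le> real_of_int (k + 1) * lambda_real D S c (k - 1)) \<and>
         (real_of_int (k + 1 - beta V S k) * mu_real D S Hodge k
           + real_of_int (beta V S k) * real (card V)
         \<ge> real_of_int (k + 1) * mu_real D S Hodge (k - 1)) \<and>
         (real_of_int (k + 1 - alpha V S k) * lambda_complex E S c k
           + real_of_int (alpha V S k) * real (card V)
         \<le> real_of_int (k + 1) * lambda_complex E S c (k - 1)) \<and>
         (real_of_int (k + 1 - beta V S k) * mu_complex E S Hodge k
           + real_of_int (beta V S k) * real (card V)
         \<ge> real_of_int (k + 1) * mu_complex E S Hodge (k - 1))"
proof -
  \<comment> \<open>The real and the complex coboundary systems are chosen independently and may
    carry different signs, hence two interpretations.\<close>
  interpret D: signed_complex V "sign_of D" S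
    using signed_simplex_sign_of[OF assms(1,3)] assms(2)
    by (simp add: signed_complex_def signed_complex_axioms_def)
  interpret E: signed_complex V "sign_of E" S
    using signed_simplex_sign_of[OF assms(1,4)] assms(2)
    by (simp add: signed_complex_def signed_complex_axioms_def)
  have ne: "faces S k \<noteq> {}" using assms by (intro faces_nonempty) auto
  \<comment> \<open>The identification holds for nonnegative dimensions and is needed for both k and
    k - 1, which is why k starts at 1.\<close>
  have "lambda_real D S c j = D.lam c j" "mu_real D S Hodge j = D.mu j"
    "lambda_complex E S c j = E.lam c j" "mu_complex E S Hodge j = E.mu j" if "j \<ge> 0" for j
    using laplacian_spectrum_eq[OF assms(1,3,2) that] laplacian_spectrum_eq[OF assms(1,4,2) that]
    by (simp_all only: lambda_real_def mu_real_def lambda_complex_def mu_complex_def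
        D.lam_def D.mu_def E.lam_def E.mu_def E.Re_complex_eigenvalues
        spectrum_op_eigenfunction[OF D.finite_faces D.lap_linear]
        spectrum_op_eigenfunction[OF E.finite_faces E.lap_linear])
  moreover have "k \<ge> 0" "k - 1 \<ge> 0" using assms(5) by auto
  ultimately show ?thesis
    using D.lam_le[OF assms(5) ne, of c] D.mu_Hodge_ge[OF assms(5) ne]
      E.lam_le[OF assms(5) ne, of c] E.mu_Hodge_ge[OF assms(5) ne]
    by (simp only: simp_thms)
qed

end
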